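(* Let $\nu\in(-2,-1]$, let $\lambda_1\le\lambda_2\le1$ be real numbers, and let $\Phi(x,y)=x^{\lambda_1}y^{\lambda_2}+y^{\lambda_1}x^{\lambda_2}$ for $(x,y)\in(0,\infty)^2$. Let $\beta(z,x,y)=\beta_*(z,x,y)\mathbf 1_{(0,x)}(z)+\beta_*(z,y,x)\mathbf 1_{(0,y)}(z)$ with $\beta_*(z,x,y)=(\nu+2)z^\nu x^{-\nu-1}\mathbf 1_{(0,x)}(z)$, for $(x,y,z)\in(0,\infty)^3$. Fix $k_0\in(|\nu|-1,1)$, an initial condition $u^{\mathrm{in}}\in X_{k_0,+}\cap X_{1+k_0}$ with $\rho:=\boldsymbol\mu_1(u^{\mathrm{in}})>0$, and $T>0$. If $\lambda_1<|\nu|-1$ and $\lambda_1+\lambda_2<1$, then the nonlinear fragmentation equation with kernel $\Phi$, daughter distribution $\beta$ and initial condition $u^{\mathrm{in}}$ does not admit a mass-conserving weak solution on $[0,T)$.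
   Context: Notation. For $k\in\mathbb R$, $X_k:=L^1((0,\infty),x^k dx)$, $X_{k,+}$ is its positive cone (non-negative functions), $X_{k,w}$ is $X_k$ with its weak topology, and $\boldsymbol\mu_k(g):=\int_0^\infty x^k g(x)\,dx$. Equation. The nonlinear fragmentation equation with symmetric collision kernel $\Phi\ge0$, daughter distribution $\beta\ge0$ and initial condition $u^{\mathrm{in}}$ is, for $(t,x)\in(0,\infty)^2$, $$\partial_t u(t,x)=\frac12\int_x^\infty\int_0^y\beta(x,y-z,z)\Phi(y-z,z)u(t,y-z)u(t,z)\,dz\,dy-\int_0^\infty\Phi(x,y)u(t,x)u(t,y)\,dy,\quad u(0,x)=u^{\mathrm{in}}(x).$$ Weak solution. Fix $k_0\in(0,1)$, a non-negative symmetric kernel $\Phi$, and a daughter distribution $\beta\ge 0$ with $\beta(z,x,y)=\beta(z,y,x)$ satisfying $\int_0^{x+y}z\beta(z,x,y)\,dz=x+y$, $\beta(z,x,y)=0$ for $z>x+y$, and $\int_0^{x+y}z^{k_0}\beta(z,x,y)\,dz\le B(x^{k_0}+y^{k_0})$ for some $B>0$ and all $(x,y)\in(0,\infty)^2$. Let $u^{\mathrm{in}}\in X_{k_0,+}\cap X_1$ and $T\in(0,\infty]$. A weak solution on $[0,T)$ is a non-negative function $u\in\mathcal C([0,T),X_{k_0,w})\cap L^\infty((0,T),X_1)$ with $u(0)=u^{\mathrm{in}}$, such that $(\tau,x,y)\mapsto(x^{k_0}+y^{k_0})\Phi(x,y)u(\tau,x)u(\tau,y)$ belongs to $L^1((0,t)\times(0,\infty)^2)$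 for every $t\in(0,T)$, and $$\int_0^\infty\varsigma(x)u(t,x)\,dx=\int_0^\infty\varsigma(x)u^{\mathrm{in}}(x)\,dx+\frac12\int_0^t\int_0^\infty\int_0^\infty\Upsilon_\varsigma(x,y)\Phi(x,y)u(\tau,x)u(\tau,y)\,dy\,dx\,d\tau$$ for all $t\in(0,T)$ and all $\varsigma\in\mathscr T^{k_0}:=\{\varsigma\in\mathcal C^{0,k_0}([0,\infty))\cap L^\infty((0,\infty)):\varsigma(0)=0\}$, where $\mathcal C^{0,k_0}([0,\infty))$ denotes Hölder continuous functions of exponent $k_0$ and $\Upsilon_\varsigma(x,y):=\int_0^{x+y}\varsigma(z)\beta(z,x,y)\,dz-\varsigma(x)-\varsigma(y)$. It is mass-conserving on $[0,T)$ if $\boldsymbol\mu_1(u(t))=\boldsymbol\mu_1(u^{\mathrm{in}})$ for all $t\in[0,T)$. *)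

theory Defs
  imports "HOL-Analysis.Analysis"
begin

text \<open>
  Throughout, a function on \<open>(0,\<infinity>)\<close> is a total function \<^typ>\<open>real \<Rightarrow> real\<close> whose values outside
  \<open>(0,\<infinity>)\<close> are never used, and an element of an \<open>L\<^sup>1\<close> space is a Borel representative of its class:
  nonnegativity and equality are understood almost everywhere.  A function of time with values in
  such a space is a curried function \<open>u t x\<close>.
\<close>

definition Xspace :: "real \<Rightarrow> (real \<Rightarrow> real) set" where
  "Xspace k = {g. set_integrable lborel {0<..} (\<lambda>x. x powr k * g x)}"

definition Xnorm :: "real \<Rightarrow> (real \<Rightarrow> real) \<Rightarrow> real" where
  "Xnorm k g = (LINT x:{0<..}|lborel. x powr k * \<bar>g x\<bar>)"

definition Xpos :: "real \<Rightarrow> (real \<Rightarrow> real) set" where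
  "Xpos k = {g \<in> Xspace k. AE x\<in>{0<..} in lborel. 0 \<le> g x}"

definition moment :: "real \<Rightarrow> (real \<Rightarrow> real) \<Rightarrow> real" where
  "moment k g = (LINT x:{0<..}|lborel. x powr k * g x)"

text \<open>
  The bounded linear functionals on \<open>Xspace k\<close>.  Since they are bounded by the seminorm
  \<open>Xnorm k\<close>, they do not distinguish representatives of the same class.
\<close>

definition Xdual :: "real \<Rightarrow> ((real \<Rightarrow> real) \<Rightarrow> real) set" where
  "Xdual k = {F.
     (\<forall>g\<in>Xspace k. \<forall>h\<in>Xspace k. F (\<lambda>x. g x + h x) = F g + F h) \<and>
     (\<forall>c. \<forall>g\<in>Xspace k. F (\<lambda>x. c * g x) = c * F g) \<and>
     (\<exists>C. \<forall>g\<in>Xspace k. \<bar>F g\<bar> \<le> C * Xnorm k g)}"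

text \<open>The initial topology on \<open>Xspace k\<close> with respect to all functionals in \<open>Xdual k\<close>.\<close>

definition Xweak :: "real \<Rightarrow> (real \<Rightarrow> real) topology" where
  "Xweak k = pullback_topology (Xspace k) (\<lambda>g. restrict (\<lambda>F. F g) (Xdual k))
               (product_topology (\<lambda>_. euclideanreal) (Xdual k))"

lemma continuous_map_Xweak_iff:
  "continuous_map (top_of_set S) (Xweak k) u \<longleftrightarrow>
     (\<forall>t\<in>S. u t \<in> Xspace k) \<and> (\<forall>F\<in>Xdual k. continuous_on S (\<lambda>t. F (u t)))"
  (is "?L \<longleftrightarrow> ?R")
proof
  let ?f = "\<lambda>g. restrict (\<lambda>F. F g) (Xdual k)"
  let ?P = "product_topology (\<lambda>_. euclideanreal) (Xdual k)"
  {
    assume L: ?L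
    have "u ` S \<subseteq> topspace (Xweak k)"
      using L by (simp add: continuous_map_def image_subset_iff Pi_iff)
    then have X: "\<forall>t\<in>S. u t \<in> Xspace k"
      by (auto simp: Xweak_def topspace_pullback_topology)
    have "continuous_map (Xweak k) ?P (id \<circ> ?f)"
      unfolding Xweak_def by (rule continuous_map_pullback) (rule continuous_map_id)
    then have "continuous_map (top_of_set S) ?P (?f \<circ> u)"
      using continuous_map_compose[OF L] by (simp add: comp_def)
    then show ?R
      using X by (simp add: continuous_map_componentwise comp_def cong: continuous_on_cong)
  }
  {
    assume R: ?R
    then have "continuous_map (top_of_set S) ?P (?f \<circ> u)"
      by (auto simp: continuous_map_componentwise comp_def)
    then show ?L
      unfolding Xweak_def
      by (rule continuous_map_pullback') (use R in auto)
  }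
qed

definition time_interval :: "ereal \<Rightarrow> real set" where
  "time_interval T = {t. 0 \<le> t \<and> ereal t < T}"

text \<open>
  Membership in \<open>L\<^sup>\<infinity>((0,T),X\<^sub>k)\<close>.  The first conjunct is strong (Bochner) measurability, which for
  functions with values in an \<open>L\<^sup>1\<close> space means the existence of a jointly measurable representative.
\<close>

definition Linfty_X :: "ereal \<Rightarrow> real \<Rightarrow> (real \<Rightarrow> real \<Rightarrow> real) \<Rightarrow> bool" where
  "Linfty_X T k u \<longleftrightarrow>
     (\<exists>v :: real \<times> real \<Rightarrow> real. v \<in> borel_measurable borel \<and>
        (AE t\<in>time_interval T in lborel. AE x\<in>{0<..} in lborel. u t x = v (t, x))) \<and>
     (\<exists>C. AE t\<in>time_interval T in lborel. u t \<in> Xspace k \<and> Xnorm k (u t) \<le> C)"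

definition holder_on :: "real set \<Rightarrow> real \<Rightarrow> (real \<Rightarrow> real) \<Rightarrow> bool" where
  "holder_on S a f \<longleftrightarrow> (\<exists>L. \<forall>x\<in>S. \<forall>y\<in>S. \<bar>f x - f y\<bar> \<le> L * \<bar>x - y\<bar> powr a)"

definition test_functions :: "real \<Rightarrow> (real \<Rightarrow> real) set" where
  "test_functions k0 = {\<sigma>. holder_on {0..} k0 \<sigma> \<and> bounded (\<sigma> ` {0<..}) \<and> \<sigma> 0 = 0}"

definition Upsilon ::
    "(real \<Rightarrow> real \<Rightarrow> real \<Rightarrow> real) \<Rightarrow> (real \<Rightarrow> real) \<Rightarrow> real \<Rightarrow> real \<Rightarrow> real" where
  "Upsilon \<beta> \<sigma> x y = (LINT z:{0<..<x + y}|lborel. \<sigma> z * \<beta> z x y) - \<sigma> x - \<sigma> y"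

text \<open>
  Weak solutions on \<open>[0,T)\<close>, with \<open>T = \<infinity>\<close> allowed.  The definition is meant for \<open>0 < k0 < 1\<close>,
  \<open>\<Phi> \<ge> 0\<close> symmetric, and \<open>\<beta> \<ge> 0\<close> symmetric in its last two arguments, conserving mass and with
  \<open>k0\<close>-moment at most \<open>B (x\<^sup>k\<^sup>0 + y\<^sup>k\<^sup>0)\<close>; the coefficients \<open>sum_kernel\<close> and \<open>power_daughter\<close> below
  have these properties when \<open>-2 < \<nu> \<le> -1\<close> and \<open>\<bar>\<nu>\<bar> - 1 < k0 < 1\<close>.
  The integrability condition is stated for the given representative \<open>u\<close>.  This is no restriction,
  because a weakly continuous curve in \<open>X\<^sub>k\<close> has a representative that is jointly Borel measurable
  and represents the right class at every time (a limit of averages over \<open>(x, x + 1/n)\<close>).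
\<close>

definition weak_solution ::
    "real \<Rightarrow> (real \<Rightarrow> real \<Rightarrow> real) \<Rightarrow> (real \<Rightarrow> real \<Rightarrow> real \<Rightarrow> real) \<Rightarrow>
     (real \<Rightarrow> real) \<Rightarrow> ereal \<Rightarrow> (real \<Rightarrow> real \<Rightarrow> real) \<Rightarrow> bool" where
  "weak_solution k0 \<Phi> \<beta> uin T u \<longleftrightarrow>
     (\<forall>t\<in>time_interval T. AE x\<in>{0<..} in lborel. 0 \<le> u t x) \<and>
     continuous_map (top_of_set (time_interval T)) (Xweak k0) u \<and>
     Linfty_X T 1 u \<and>
     (AE x\<in>{0<..} in lborel. u 0 x = uin x) \<and>
     (\<forall>t. 0 < t \<and> ereal t < T \<longrightarrow>
        set_integrable lborel ({0<..<t} \<times> {0<..} \<times> {0<..})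
          (\<lambda>(\<tau>, x, y). (x powr k0 + y powr k0) * \<Phi> x y * u \<tau> x * u \<tau> y)) \<and>
     (\<forall>t. 0 < t \<and> ereal t < T \<longrightarrow> (\<forall>\<sigma>\<in>test_functions k0.
        (LINT x:{0<..}|lborel. \<sigma> x * u t x) =
        (LINT x:{0<..}|lborel. \<sigma> x * uin x) +
        1 / 2 * (LINT \<tau>:{0<..<t}|lborel. (LINT x:{0<..}|lborel. (LINT y:{0<..}|lborel.
          Upsilon \<beta> \<sigma> x y * \<Phi> x y * u \<tau> x * u \<tau> y)))))"

text \<open>
  Membership in \<open>Xspace 1\<close> is explicit because the integral in \<^const>\<open>moment\<close> is \<open>0\<close> for
  non-integrable functions.
\<close>

definition mass_conserving ::
    "(real \<Rightarrow> real) \<Rightarrow> ereal \<Rightarrow> (real \<Rightarrow> real \<Rightarrow> real) \<Rightarrow> bool" where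
  "mass_conserving uin T u \<longleftrightarrow>
     (\<forall>t\<in>time_interval T. u t \<in> Xspace 1 \<and> moment 1 (u t) = moment 1 uin)"

definition sum_kernel :: "real \<Rightarrow> real \<Rightarrow> real \<Rightarrow> real \<Rightarrow> real" where
  "sum_kernel lam1 lam2 x y = x powr lam1 * y powr lam2 + y powr lam1 * x powr lam2"

definition power_daughter_star :: "real \<Rightarrow> real \<Rightarrow> real \<Rightarrow> real \<Rightarrow> real" where
  "power_daughter_star \<nu> z x y =
     (\<nu> + 2) * z powr \<nu> * x powr (- \<nu> - 1) * indicator {0<..<x} z"

definition power_daughter :: "real \<Rightarrow> real \<Rightarrow> real \<Rightarrow> real \<Rightarrow> real" where
  "power_daughter \<nu> z x y =
     power_daughter_star \<nu> z x y * indicator {0<..<x} z +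
     power_daughter_star \<nu> z y x * indicator {0<..<y} z"

end

theory Submission
  imports Defs "HOL-Real_Asymp.Real_Asymp"
begin

text \<open>
  The contradiction comes from the small fragments.  Weak continuity keeps the mass in some compact
  window of \<open>(0,\<infinity>)\<close> bounded below on a short time interval \<open>[0,t\<^sub>1]\<close>, and the integrability built
  into the notion of weak solution makes the moments \<open>m\<^sub>1, m\<^sub>2\<close> of orders \<open>lam1, lam2\<close> finite at
  almost every time.  Test with a hat function of height and width comparable to a small \<open>e\<close>, and
  let \<open>S\<close> be the resulting functional.  Fragmentation of the window feeds \<open>S\<close> at a rate at least
  \<open>(m\<^sub>1 + m\<^sub>2) e\<^bsup>\<nu> + 2\<^esup>\<close>, and \<open>S\<close> loses at most \<open>(m\<^sub>1 + m\<^sub>2) e\<^bsup>lam1\<^esup> S\<close>, up to constants.  Both rates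
  carry the same factor \<open>m\<^sub>1 + m\<^sub>2\<close>, so no bound on it is needed: below a threshold of order
  \<open>e\<^bsup>\<nu> + 2 - lam1\<^esup>\<close> the functional increases at least at speed \<open>e\<^bsup>\<nu> + 2\<^esup>\<close>, whence
  \<open>e\<^bsup>lam1\<^esup> S(t) \<ge> \<eta> e\<close> with \<open>\<eta> > 0\<close> independent of \<open>e\<close>, by \<open>\<nu> \<le> -1\<close> and \<open>lam1 < -\<nu> - 1\<close>.  On the
  other hand \<open>e\<^bsup>lam1\<^esup> S(t) = o(e)\<close> as soon as the moment of order \<open>lam1\<close> is finite at time \<open>t\<close>.
\<close>

subsection \<open>Hat functions and their fragmentation\<close>

text \<open>For \<open>e > 0\<close> this is a tent on \<open>[e, 3 * e]\<close> with height
  \<open>e\<close> at \<open>2 * e\<close>. It is Lipschitz, hence an admissible test function, and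
  it vanishes near 0, so that \<open>hat e z * z powr \<nu>\<close> is integrable even for
  \<open>\<nu> \<le> -1\<close>.\<close>

definition hat :: "real \<Rightarrow> real \<Rightarrow> real" where
  "hat e x = max 0 (min (x - e) (3 * e - x))"

text \<open>The integral of \<open>\<sigma>\<close> over the fragments of a single particle of size
  \<open>x\<close>, that is, against \<open>power_daughter_star \<nu> z x y\<close>, whose value
  does not depend on the collision partner \<open>y\<close>.\<close>

definition frag_moment :: "real \<Rightarrow> (real \<Rightarrow> real) \<Rightarrow> real \<Rightarrow> real" where
  "frag_moment \<nu> \<sigma> x = (\<nu> + 2) * x powr (- \<nu> - 1) * (LINT z:{0<..<x}|lborel. \<sigma> z * z powr \<nu>)"

text \<open>Each particle breaks up on its own, so the gain is a sum over the two partners; the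
  integrability of \<open>\<sigma> z * z powr \<nu>\<close> allows the integral to be split.
  Together with the product form of the kernel this reduces double integrals to products of
  moments.\<close>

lemma Upsilon_power_daughter:
  assumes "integrable lborel (\<lambda>z. \<sigma> z * z powr \<nu>)" and "0 < x" and "0 < y"
  shows "Upsilon (power_daughter \<nu>) \<sigma> x y
    = (frag_moment \<nu> \<sigma> x - \<sigma> x) + (frag_moment \<nu> \<sigma> y - \<sigma> y)"
proof -
  let ?f = "\<lambda>z. \<sigma> z * z powr \<nu>"
  have i: "integrable lborel (\<lambda>z. indicator {0<..<x} z * ?f z)" for x :: real
    using integrable_mult_indicator[OF _ assms(1), of "{0<..<x}"] by simp
  have "(LINT z:{0<..<x + y}|lborel. \<sigma> z * power_daughter \<nu> z x y) =
    (LINT z|lborel. (\<nu> + 2) * x powr (- \<nu> - 1) * (indicator {0<..<x} z * ?f z)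
      + (\<nu> + 2) * y powr (- \<nu> - 1) * (indicator {0<..<y} z * ?f z))"
    unfolding set_lebesgue_integral_def power_daughter_def power_daughter_star_def
    using assms(2,3)
    by (intro Bochner_Integration.integral_cong) (auto simp: indicator_def algebra_simps)
  also have "\<dots> = frag_moment \<nu> \<sigma> x + frag_moment \<nu> \<sigma> y"
    using i[of x] i[of y] by (simp add: frag_moment_def set_lebesgue_integral_def)
  finally show ?thesis by (simp add: Upsilon_def)
qed

lemma measurable_hat [measurable]: "hat e \<in> borel_measurable borel"
  unfolding hat_def by measurable

lemma hat_nonneg: "0 \<le> hat e x" and hat_le: "hat e x \<le> \<bar>e\<bar>"
  by (auto simp: hat_def)

lemma hat_eq_0: "x \<le> e \<or> 3 * e \<le> x \<Longrightarrow> hat e x = 0"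
  by (auto simp: hat_def)

text \<open>The hat lives on \<open>x > e\<close>, where \<open>e powr k \<le> x powr k\<close>. The
  bound makes integration against the hat a weakly continuous functional.\<close>

lemma hat_bound_powr:
  assumes "0 < e" "0 \<le> k" "0 < x"
  shows "hat e x \<le> e * e powr (- k) * x powr k"
proof (cases "x \<le> e")
  case True
  then show ?thesis using assms by (simp add: hat_eq_0)
next
  case False
  then have "e powr k \<le> x powr k" using assms by (intro powr_mono2) auto
  then have "e * (e powr (-k) * e powr k) \<le> e * (e powr (-k) * x powr k)"
    using assms by (intro mult_left_mono) auto
  moreover have "e powr (-k) * e powr k = 1" using assms by (simp flip: powr_add)
  ultimately have "e * 1 \<le> e * (e powr (-k) * x powr k)" by simp
  then show ?thesis using hat_le[of e x] assms by (simp only: mult.assoc)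
qed

lemma hat_test_function:
  assumes "0 < e" "0 < k" "k \<le> 1"
  shows "hat e \<in> test_functions k"
proof -
  have lip: "\<bar>hat e x - hat e y\<bar> \<le> \<bar>x - y\<bar>" for x y by (auto simp: hat_def)
  have bd: "\<bar>hat e x - hat e y\<bar> \<le> e" for x y
    using hat_nonneg[of e x] hat_nonneg[of e y] hat_le[of e x] hat_le[of e y] assms by auto
  \<comment> \<open>Distances up to 1 are handled by the Lipschitz bound, larger ones by the bound
    \<open>e\<close>; the constant \<open>1 + e\<close> serves both.\<close>
  have "\<bar>hat e x - hat e y\<bar> \<le> (1 + e) * \<bar>x - y\<bar> powr k" for x y
  proof (cases "\<bar>x - y\<bar> \<le> 1")
    case True
    then have "\<bar>x - y\<bar> powr 1 \<le> \<bar>x - y\<bar> powr k" using assms by (intro powr_mono') auto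
    then have "\<bar>x - y\<bar> \<le> \<bar>x - y\<bar> powr k" by simp
    also have "\<dots> \<le> (1 + e) * \<bar>x - y\<bar> powr k" using assms by (simp add: algebra_simps)
    finally show ?thesis using lip[of x y] by simp
  next
    case False
    then have "1 \<le> \<bar>x - y\<bar> powr k" using assms by (intro ge_one_powr_ge_zero) auto
    then have "e * 1 \<le> (1 + e) * \<bar>x - y\<bar> powr k" using assms by (intro mult_mono) auto
    then show ?thesis using bd[of x y] by simp
  qed
  then have "holder_on {0..} k (hat e)" unfolding holder_on_def by blast
  moreover have "bounded (hat e ` {0<..})"
    using hat_nonneg hat_le assms by (auto simp: bounded_iff intro!: exI[of _ e]) (metis abs_of_pos)
  ultimately show ?thesis using assms by (simp add: test_functions_def hat_eq_0)
qed

lemma integrable_hat_powr: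
  assumes "0 < e" shows "integrable lborel (\<lambda>z. hat e z * z powr b)"
proof (rule integrableI_bounded_set[where A = "{e..3*e}" and B = "e * (e powr b + (3*e) powr b)"])
  show "AE x in lborel. x \<in> {e..3*e} \<longrightarrow> norm (hat e x * x powr b) \<le> e * (e powr b + (3*e) powr b)"
  proof (intro AE_I2 impI)
    fix x assume x: "x \<in> {e..3*e}"
    have "x powr b \<le> e powr b + (3*e) powr b"
    proof (cases "0 \<le> b")
      case True then have "x powr b \<le> (3*e) powr b" using x assms by (intro powr_mono2) auto
      then show ?thesis using powr_ge_zero[of e b] by linarith
    next
      case False then have "x powr b \<le> e powr b" using x assms by (intro powr_mono2') auto
      then show ?thesis using powr_ge_zero[of "3*e" b] by linarith
    qed
    then have "hat e x * x powr b \<le> e * (e powr b + (3*e) powr b)"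
      using hat_le[of e x] assms by (intro mult_mono) auto
    then show "norm (hat e x * x powr b) \<le> e * (e powr b + (3*e) powr b)"
      using hat_nonneg by simp
  qed
qed (use assms in \<open>auto simp: indicator_def hat_eq_0\<close>)

text \<open>On the middle half \<open>[3/2 * e, 5/2 * e]\<close> of the support, of length
  \<open>e\<close>, the hat is at least \<open>e / 2\<close> and \<open>z powr b\<close> at least
  \<open>(3 * e) powr b\<close>.\<close>

lemma hat_powr_integral_ge:
  assumes "0 < e" "b \<le> 0"
  shows "3 powr b / 2 * e powr (b + 2) \<le> (LINT z|lborel. hat e z * z powr b)"
proof -
  have "3 powr b / 2 * e powr (b + 2) = (LINT z|lborel. indicator {3/2*e..5/2*e} z * (e / 2 * (3*e) powr b))"
    using assms by (simp add: powr_add powr_mult power2_eq_square)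
  also have "\<dots> \<le> (LINT z|lborel. hat e z * z powr b)"
  proof (rule integral_mono)
    fix z
    show "indicator {3/2*e..5/2*e} z * (e / 2 * (3*e) powr b) \<le> hat e z * z powr b"
    proof (cases "z \<in> {3/2*e..5/2*e}")
      case True
      then have "(3*e) powr b \<le> z powr b" using assms by (intro powr_mono2') auto
      moreover have "e / 2 \<le> hat e z" using True by (auto simp: hat_def)
      ultimately have "e / 2 * (3*e) powr b \<le> hat e z * z powr b"
        using assms hat_nonneg by (intro mult_mono) auto
      then show ?thesis using True by simp
    qed (use hat_nonneg in auto)
  qed (use assms in \<open>auto intro!: integrable_hat_powr integrable_mult_left\<close>)
  finally show ?thesis .
qed

text \<open>The integral \<open>?I x\<close> increases from 0 (for \<open>x \<le> e\<close>) to
  \<open>J\<close> (from \<open>3 * e\<close> on). Monotonicity gives measurability and saturation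
  the exact value; for \<open>x > e\<close> the nonpositive exponent \<open>- \<nu> - 1 - k\<close>
  allows \<open>x\<close> to be replaced by \<open>e\<close> in the growth bound.\<close>

lemma frag_moment_hat:
  fixes \<nu> e :: real
  defines "J \<equiv> LINT z|lborel. hat e z * z powr \<nu>"
  assumes "0 < e" "-2 < \<nu>"
  shows "frag_moment \<nu> (hat e) \<in> borel_measurable borel"
    and "0 \<le> frag_moment \<nu> (hat e) x"
    and "3 * e \<le> x \<Longrightarrow> frag_moment \<nu> (hat e) x = (\<nu> + 2) * x powr (- \<nu> - 1) * J"
    and "- \<nu> - 1 \<le> k \<Longrightarrow> 0 < x \<Longrightarrow>
      frag_moment \<nu> (hat e) x \<le> (\<nu> + 2) * J * e powr (- \<nu> - 1 - k) * x powr k"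
proof -
  let ?f = "\<lambda>z. hat e z * z powr \<nu>"
  let ?I = "\<lambda>x. LINT z:{0<..<x}|lborel. ?f z"
  have f: "0 \<le> ?f z" for z using hat_nonneg by simp
  have i: "set_integrable lborel {0<..<x} ?f" for x
    unfolding set_integrable_def
    by (intro integrable_mult_indicator integrable_hat_powr) (use assms in auto)
  have "mono ?I"
    unfolding set_lebesgue_integral_def
    by (intro monoI integral_mono i[unfolded set_integrable_def] )
      (use f in \<open>auto simp: indicator_def\<close>)
  then have [measurable]: "?I \<in> borel_measurable borel" by (rule borel_measurable_mono)
  show "frag_moment \<nu> (hat e) \<in> borel_measurable borel"
    unfolding frag_moment_def[abs_def] by measurable
  have I0: "0 \<le> ?I x" for x
    unfolding set_lebesgue_integral_def using f by (auto intro!: integral_nonneg simp: indicator_def)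
  then show "0 \<le> frag_moment \<nu> (hat e) x" using assms by (simp add: frag_moment_def)
  have IJ: "?I x \<le> J"
    unfolding J_def set_lebesgue_integral_def
    by (intro integral_mono i[unfolded set_integrable_def] integrable_hat_powr)
      (use f assms in \<open>auto simp: indicator_def\<close>)
  show "frag_moment \<nu> (hat e) x = (\<nu> + 2) * x powr (- \<nu> - 1) * J" if "3 * e \<le> x"
  proof -
    have "indicator {0<..<x} z *\<^sub>R ?f z = ?f z" for z
      using that assms(2) hat_eq_0[of z e] by (cases "z \<in> {0<..<x}") auto
    then have "?I x = J" unfolding J_def set_lebesgue_integral_def by presburger
    then show ?thesis by (simp add: frag_moment_def)
  qed
  show "frag_moment \<nu> (hat e) x \<le> (\<nu> + 2) * J * e powr (- \<nu> - 1 - k) * x powr k"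
    if "- \<nu> - 1 \<le> k" "0 < x"
  proof (cases "x \<le> e")
    case True
    have "indicator {0<..<x} z *\<^sub>R ?f z = 0" for z
      using True hat_eq_0[of z e] by (cases "z \<in> {0<..<x}") auto
    then have "?I x = (LINT z::real|lborel. 0)" unfolding set_lebesgue_integral_def by presburger
    moreover have "0 \<le> J" using I0 IJ by (rule order_trans)
    ultimately show ?thesis using assms by (simp add: frag_moment_def)
  next
    case False
    have "x powr (- \<nu> - 1 - k) \<le> e powr (- \<nu> - 1 - k)"
      using False that assms by (intro powr_mono2') auto
    then have "x powr (- \<nu> - 1 - k) * x powr k \<le> e powr (- \<nu> - 1 - k) * x powr k"
      by (intro mult_right_mono) auto
    then have "x powr (- \<nu> - 1) \<le> e powr (- \<nu> - 1 - k) * x powr k"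
      using that by (simp flip: powr_add)
    then have "x powr (- \<nu> - 1) * ?I x \<le> (e powr (- \<nu> - 1 - k) * x powr k) * J"
      using IJ I0 by (intro mult_mono) auto
    then have "(\<nu> + 2) * (x powr (- \<nu> - 1) * ?I x) \<le> (\<nu> + 2) * ((e powr (- \<nu> - 1 - k) * x powr k) * J)"
      using assms by (intro mult_left_mono) auto
    then show ?thesis by (simp add: frag_moment_def mult_ac)
  qed
qed

subsection \<open>Collision integrals for the sum kernel\<close>

lemma sum_kernel_nonneg: "0 \<le> sum_kernel a b x y"
  by (simp add: sum_kernel_def)

text \<open>Freeze an \<open>x\<close> with \<open>H x \<noteq> 0\<close> whose section is
  integrable. The integrand is then a sum of four monomials in \<open>y\<close>, of orders
  \<open>a\<close>, \<open>b\<close>, \<open>k + a\<close>, \<open>k + b\<close>, with positive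
  coefficients, times \<open>H x * H y\<close>; so each of these moments is finite.\<close>

lemma integrable_powr_of_collision:
  fixes H :: "real \<Rightarrow> real"
  assumes [measurable]: "H \<in> borel_measurable borel" and H0: "\<And>x. x \<le> 0 \<Longrightarrow> H x = 0"
    and int: "integrable (lborel \<Otimes>\<^sub>M lborel)
      (\<lambda>(x, y). (x powr k + y powr k) * sum_kernel a b x y * H x * H y)"
    and nz: "\<not> (AE x in lborel. H x = 0)"
    and s: "s \<in> {a, b, k + a, k + b}"
  shows "integrable lborel (\<lambda>x. x powr s * H x)"
proof -
  have "AE x in lborel. integrable lborel
      (\<lambda>y. (x powr k + y powr k) * sum_kernel a b x y * H x * H y)"
    using lborel_pair.AE_integrable_fst'[OF int] by simp
  then obtain x where x: "H x \<noteq> 0"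
    and i: "integrable lborel (\<lambda>y. (x powr k + y powr k) * sum_kernel a b x y * H x * H y)"
    using nz by (metis (mono_tags, lifting) eventually_mono)
  have "0 < x" using x H0[of x] by force
  define c where "c = min (min (x powr (k + b)) (x powr (k + a))) (min (x powr a) (x powr b)) * \<bar>H x\<bar>"
  have "0 < c" using x \<open>0 < x\<close> by (simp add: c_def)
  have "integrable lborel (\<lambda>y. c * (y powr s * H y))"
  proof (rule Bochner_Integration.integrable_bound[OF i])
    show "AE y in lborel. norm (c * (y powr s * H y))
      \<le> norm ((x powr k + y powr k) * sum_kernel a b x y * H x * H y)"
    proof (rule AE_I2)
      fix y
      show "norm (c * (y powr s * H y))
        \<le> norm ((x powr k + y powr k) * sum_kernel a b x y * H x * H y)"
      proof (cases "0 < y")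
        case True
        let ?m = "min (min (x powr (k + b)) (x powr (k + a))) (min (x powr a) (x powr b))"
        have "?m * y powr s \<le> x powr (k + b) * y powr a + x powr (k + a) * y powr b
            + x powr b * y powr (k + a) + x powr a * y powr (k + b)" (is "_ \<le> ?r")
        proof -
          have "?m * y powr s \<le> x powr (k + b) * y powr s" "?m * y powr s \<le> x powr (k + a) * y powr s"
            "?m * y powr s \<le> x powr b * y powr s" "?m * y powr s \<le> x powr a * y powr s"
            by (intro mult_right_mono; simp)+
          moreover have "0 \<le> x powr (k + b) * y powr a" "0 \<le> x powr (k + a) * y powr b"
            "0 \<le> x powr b * y powr (k + a)" "0 \<le> x powr a * y powr (k + b)" by simp_all
          ultimately show ?thesis using s by (elim insertE emptyE; hypsubst; linarith)
        qed
        also have "?r = (x powr k + y powr k) * sum_kernel a b x y"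
          by (simp add: sum_kernel_def powr_add algebra_simps)
        finally have "?m * y powr s * (\<bar>H x\<bar> * \<bar>H y\<bar>)
          \<le> (x powr k + y powr k) * sum_kernel a b x y * (\<bar>H x\<bar> * \<bar>H y\<bar>)"
          by (intro mult_right_mono) auto
        moreover have "0 \<le> ?m" by simp
        ultimately show ?thesis
          by (simp add: c_def abs_mult sum_kernel_nonneg mult_ac)
      qed (simp add: H0)
    qed
  qed measurable
  then show ?thesis using \<open>0 < c\<close> by simp
qed

text \<open>The integrand separates into four products of a function of \<open>x\<close> and one of
  \<open>y\<close>; by symmetry they pair up, which gives the factor 2.\<close>

lemma collision_integral_split:
  fixes H w :: "real \<Rightarrow> real"
  assumes "\<And>s. s \<in> {a, b} \<Longrightarrow> integrable lborel (\<lambda>x. x powr s * H x)"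
    and "\<And>s. s \<in> {a, b} \<Longrightarrow> integrable lborel (\<lambda>x. w x * x powr s * H x)"
  shows "(LINT x|lborel. LINT y|lborel. (w x + w y) * sum_kernel a b x y * H x * H y) =
    2 * ((LINT x|lborel. w x * x powr a * H x) * (LINT x|lborel. x powr b * H x)
       + (LINT x|lborel. w x * x powr b * H x) * (LINT x|lborel. x powr a * H x))"
proof -
  define p q where "p = (LINT x|lborel. x powr a * H x)" and "q = (LINT x|lborel. x powr b * H x)"
  define P Q where "P = (LINT x|lborel. w x * x powr a * H x)"
    and "Q = (LINT x|lborel. w x * x powr b * H x)"
  note i = assms(1)[of a, simplified] assms(1)[of b, simplified]
    assms(2)[of a, simplified] assms(2)[of b, simplified]
  have "(LINT y|lborel. (w x + w y) * sum_kernel a b x y * H x * H y) =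
      q * (w x * x powr a * H x) + p * (w x * x powr b * H x)
      + Q * (x powr a * H x) + P * (x powr b * H x)" for x
  proof -
    have "(LINT y|lborel. (w x + w y) * sum_kernel a b x y * H x * H y) =
      (LINT y|lborel. (w x * x powr a * H x) * (y powr b * H y)
        + (w x * x powr b * H x) * (y powr a * H y)
        + (x powr a * H x) * (w y * y powr b * H y)
        + (x powr b * H x) * (w y * y powr a * H y))"
      by (intro Bochner_Integration.integral_cong) (auto simp: sum_kernel_def algebra_simps)
    also have "\<dots> = (w x * x powr a * H x) * q + (w x * x powr b * H x) * p
        + (x powr a * H x) * Q + (x powr b * H x) * P"
      using i by (simp add: p_def q_def P_def Q_def)
    finally show ?thesis by (simp add: mult_ac)
  qed
  then have "(LINT x|lborel. LINT y|lborel. (w x + w y) * sum_kernel a b x y * H x * H y)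
    = q * P + p * Q + Q * p + P * q"
    using i by (simp add: p_def q_def P_def Q_def)
  then show ?thesis by (simp add: p_def q_def P_def Q_def algebra_simps)
qed

text \<open>Monotonicity in the base, for either sign of the exponent. It is applied on the support
  of a hat, where \<open>x\<close> and \<open>e\<close> differ by a factor of at most 3.\<close>

lemma powr_le_scaled:
  fixes x y s :: real
  assumes "0 < x" "x \<le> 3 * y" "y \<le> 3 * x"
  shows "x powr s \<le> 3 powr \<bar>s\<bar> * y powr s"
proof (cases "0 \<le> s")
  case True
  then have "x powr s \<le> (3 * y) powr s" using assms by (intro powr_mono2) auto
  then show ?thesis using True assms by (simp add: powr_mult)
next
  case False
  then have "x powr s \<le> (y / 3) powr s" using assms by (intro powr_mono2') auto
  also have "\<dots> = 3 powr (- s) * y powr s" using assms by (simp add: powr_divide powr_minus field_simps)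
  finally show ?thesis using False by simp
qed

text \<open>
  The smallness assumption keeps the loss below half of the gain, separately for each of the two
  factors of the kernel; one \<open>N\<close> comes from the gain and the other from the moment of order \<open>b\<close>.
\<close>

lemma collision_rate_ge:
  fixes H :: "real \<Rightarrow> real" and \<nu> a b c d e k p q :: real
  defines "w \<equiv> \<lambda>x. frag_moment \<nu> (hat e) x - hat e x"
    and "J \<equiv> LINT z|lborel. hat e z * z powr \<nu>"
    and "N \<equiv> LINT x|lborel. indicator {p..q} x * x * H x"
  assumes [measurable]: "H \<in> borel_measurable borel" and H0: "\<And>x. x \<le> 0 \<Longrightarrow> H x = 0"
    and nonneg: "AE x in lborel. 0 \<le> H x"
    and int: "integrable (lborel \<Otimes>\<^sub>M lborel)
      (\<lambda>(x, y). (x powr k + y powr k) * sum_kernel a b x y * H x * H y)"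
    and "0 < N" and "0 < p" and "- 2 < \<nu>" "- \<nu> - 1 \<le> k" "0 \<le> k" and "a \<le> b"
    and e: "0 < e" "3 * e \<le> 1" "3 * e \<le> p"
    and "0 \<le> c" and c: "\<And>x s. x \<in> {p..q} \<Longrightarrow> s \<in> {a, b} \<Longrightarrow> c * x \<le> (\<nu> + 2) * x powr (- \<nu> - 1) * x powr s"
    and d: "\<And>x. x \<in> {p..q} \<Longrightarrow> d * x \<le> x powr b"
    and small: "2 * 3 powr \<bar>a\<bar> * e powr a * (LINT x|lborel. hat e x * H x) \<le> c * J * N"
  shows "c * d * J * N\<^sup>2 \<le> (LINT x|lborel. LINT y|lborel. (w x + w y) * sum_kernel a b x y * H x * H y)"
proof -
  let ?W = "frag_moment \<nu> (hat e)"
  have [measurable]: "?W \<in> borel_measurable borel" using frag_moment_hat(1) e assms by simp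
  have nz: "\<not> (AE x in lborel. H x = 0)"
  proof
    assume "AE x in lborel. H x = 0"
    then have "N = (LINT x::real|lborel. 0)"
      unfolding N_def by (intro integral_cong_AE) auto
    then show False using \<open>0 < N\<close> by simp
  qed
  note i = integrable_powr_of_collision[OF _ H0 int nz, simplified]
  have iab: "integrable lborel (\<lambda>x. x powr s * H x)" "integrable lborel (\<lambda>x. x powr (k + s) * H x)"
    if "s \<in> {a, b}" for s using that i by auto
  \<comment> \<open>A nonintegrable function has integral 0, so \<open>0 < N\<close> forces
    integrability.\<close>
  have iN: "integrable lborel (\<lambda>x. indicator {p..q} x * x * H x)"
    using \<open>0 < N\<close> unfolding N_def by (metis less_irrefl not_integrable_integral_eq)
  have J0: "0 \<le> J"
    unfolding J_def using hat_nonneg by (auto intro!: integral_nonneg)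
  \<comment> \<open>The growth bound of order \<open>k\<close> on \<open>?W\<close> turns this into
    the moment of order \<open>k + s\<close>, which is finite.\<close>
  have iW: "integrable lborel (\<lambda>x. ?W x * x powr s * H x)" if s: "s \<in> {a, b}" for s
  proof (rule Bochner_Integration.integrable_bound)
    define D where "D = (\<nu> + 2) * J * e powr (- \<nu> - 1 - k)"
    show "integrable lborel (\<lambda>x. D * (x powr (k + s) * H x))" using iab(2)[OF s] by simp
    show "AE x in lborel. norm (?W x * x powr s * H x) \<le> norm (D * (x powr (k + s) * H x))"
    proof (rule AE_I2)
      fix x :: real
      have "?W x * (x powr s * \<bar>H x\<bar>) \<le> (D * x powr k) * (x powr s * \<bar>H x\<bar>)" if "0 < x"
        using frag_moment_hat(4)[of e \<nu> k x] assms that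
        by (intro mult_right_mono) (auto simp: D_def J_def)
      moreover have "0 \<le> D" using J0 assms by (simp add: D_def)
      ultimately show "norm (?W x * x powr s * H x) \<le> norm (D * (x powr (k + s) * H x))"
        using frag_moment_hat(2)[of e \<nu> x] assms
        by (cases "0 < x") (auto simp: abs_mult powr_add mult_ac)
    qed
  qed measurable
  have ihat: "integrable lborel (\<lambda>x. hat e x * H x)"
  proof (rule Bochner_Integration.integrable_bound)
    show "integrable lborel (\<lambda>x. e * 3 powr \<bar>a\<bar> * e powr (- a) * (x powr a * H x))"
      using iab(1)[of a] by simp
    show "AE x in lborel. norm (hat e x * H x) \<le> norm (e * 3 powr \<bar>a\<bar> * e powr (- a) * (x powr a * H x))"
    proof (rule AE_I2)
      fix x :: real
      show "norm (hat e x * H x) \<le> norm (e * 3 powr \<bar>a\<bar> * e powr (- a) * (x powr a * H x))"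
      proof (cases "x \<le> e \<or> 3 * e \<le> x")
        case False
        then have "e powr (- a) * e powr a \<le> e powr (- a) * (3 powr \<bar>a\<bar> * x powr a)"
          using e by (intro mult_left_mono powr_le_scaled) auto
        then have "hat e x * 1 \<le> e * (3 powr \<bar>a\<bar> * e powr (- a) * x powr a)"
          using e hat_le[of e x] by (intro mult_mono) (auto simp: mult_ac simp flip: powr_add)
        then have "hat e x * \<bar>H x\<bar> \<le> e * (3 powr \<bar>a\<bar> * e powr (- a) * x powr a) * \<bar>H x\<bar>"
          by (intro mult_right_mono) auto
        then show ?thesis using hat_nonneg[of e x] e by (simp add: abs_mult mult_ac)
      qed (simp add: hat_eq_0)
    qed
  qed measurable
  \<comment> \<open>As \<open>3 * e \<le> 1\<close>, sizes in the support are below 1, where the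
    smaller order \<open>a\<close> gives the larger power. Hence both orders obey the same bound by
    \<open>e powr a\<close>.\<close>
  have powr_small: "x powr s \<le> 3 powr \<bar>a\<bar> * e powr a" if "e < x" "x < 3 * e" "s \<in> {a, b}" for x s
  proof -
    have "x powr s \<le> x powr a" using that e \<open>a \<le> b\<close> by (intro powr_mono') auto
    also have "\<dots> \<le> 3 powr \<bar>a\<bar> * e powr a" using that e by (intro powr_le_scaled) auto
    finally show ?thesis .
  qed
  have hat_le': "hat e x * x powr s \<le> 3 powr \<bar>a\<bar> * e powr a * hat e x" if "s \<in> {a, b}" for x s
  proof (cases "x \<le> e \<or> 3 * e \<le> x")
    case False
    then show ?thesis using mult_left_mono[OF powr_small[of x s] hat_nonneg[of e x]] that
      by (simp add: mult_ac)
  qed (simp add: hat_eq_0)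
  have ihat': "integrable lborel (\<lambda>x. hat e x * x powr s * H x)" if s: "s \<in> {a, b}" for s
  proof (rule Bochner_Integration.integrable_bound)
    show "integrable lborel (\<lambda>x. 3 powr \<bar>a\<bar> * e powr a * (hat e x * H x))" using ihat by simp
    show "AE x in lborel. norm (hat e x * x powr s * H x) \<le> norm (3 powr \<bar>a\<bar> * e powr a * (hat e x * H x))"
    proof (rule AE_I2)
      fix x
      show "norm (hat e x * x powr s * H x) \<le> norm (3 powr \<bar>a\<bar> * e powr a * (hat e x * H x))"
        using mult_right_mono[OF hat_le'[OF s], of "\<bar>H x\<bar>" x] hat_nonneg[of e x]
        by (simp add: abs_mult mult_ac)
    qed
  qed measurable
  \<comment> \<open>Gain minus loss for one order. On \<open>[p, q]\<close>, beyond the support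
    because \<open>3 * e \<le> p\<close>, the gain is explicit and contributes at least
    \<open>c * J * N\<close>; \<open>small\<close> bounds the loss by half of this.\<close>
  have rate: "c * J * N / 2 \<le> (LINT x|lborel. w x * x powr s * H x)" if s: "s \<in> {a, b}" for s
  proof -
    have "c * J * N = (LINT x|lborel. c * J * (indicator {p..q} x * x * H x))"
      unfolding N_def by simp
    also have "\<dots> \<le> (LINT x|lborel. ?W x * x powr s * H x)"
    proof (rule integral_mono_AE)
      show "AE x in lborel. c * J * (indicator {p..q} x * x * H x) \<le> ?W x * x powr s * H x"
        using nonneg
      proof eventually_elim
        case (elim x)
        show ?case
        proof (cases "x \<in> {p..q}")
          case True
          then have W: "?W x = (\<nu> + 2) * x powr (- \<nu> - 1) * J"
            using frag_moment_hat(3)[of e \<nu> x] e assms by (auto simp: J_def)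
          have "c * x * (J * H x) \<le> (\<nu> + 2) * x powr (- \<nu> - 1) * x powr s * (J * H x)"
            using c[OF True s] J0 elim by (intro mult_right_mono) auto
          then show ?thesis using True by (simp add: W mult_ac)
        next
          case False
          then show ?thesis using frag_moment_hat(2)[of e \<nu> x] e assms elim by simp
        qed
      qed
    qed (use iN iW[OF s] in auto)
    finally have 1: "c * J * N \<le> (LINT x|lborel. ?W x * x powr s * H x)" .
    have "(LINT x|lborel. hat e x * x powr s * H x) \<le> (LINT x|lborel. 3 powr \<bar>a\<bar> * e powr a * (hat e x * H x))"
    proof (rule integral_mono_AE)
      show "AE x in lborel. hat e x * x powr s * H x \<le> 3 powr \<bar>a\<bar> * e powr a * (hat e x * H x)"
        using nonneg
        by eventually_elim (use mult_right_mono[OF hat_le'[OF s]] in \<open>simp add: mult_ac\<close>)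
    qed (use ihat ihat'[OF s] in auto)
    then have 2: "(LINT x|lborel. hat e x * x powr s * H x) \<le> c * J * N / 2"
      using small by simp
    have "(LINT x|lborel. w x * x powr s * H x)
      = (LINT x|lborel. ?W x * x powr s * H x) - (LINT x|lborel. hat e x * x powr s * H x)"
      using iW[OF s] ihat'[OF s] by (simp add: w_def left_diff_distrib)
    then show ?thesis using 1 2 by simp
  qed
  have iw: "integrable lborel (\<lambda>x. w x * x powr s * H x)" if "s \<in> {a, b}" for s
    using iW[OF that] ihat'[OF that] by (simp add: w_def left_diff_distrib)
  have cJN: "0 \<le> c * J * N / 2" using J0 \<open>0 \<le> c\<close> \<open>0 < N\<close> by simp
  have "0 \<le> (LINT x|lborel. x powr a * H x)"
    using nonneg by (intro integral_nonneg_AE) auto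
  \<comment> \<open>Of the two products in \<open>collision_integral_split\<close> this one is
    discarded as nonnegative. The other is bounded below, and the factor 2 in front cancels the half
    in \<open>rate\<close>.\<close>
  then have A: "0 \<le> (LINT x|lborel. w x * x powr b * H x) * (LINT x|lborel. x powr a * H x)"
    using rate[of b] cJN by (intro mult_nonneg_nonneg) auto
  have "d * N = (LINT x|lborel. d * (indicator {p..q} x * x * H x))" unfolding N_def by simp
  also have "\<dots> \<le> (LINT x|lborel. x powr b * H x)"
  proof (rule integral_mono_AE)
    show "AE x in lborel. d * (indicator {p..q} x * x * H x) \<le> x powr b * H x"
      using nonneg
      by eventually_elim (use d in \<open>auto simp: indicator_def mult.assoc[symmetric] intro!: mult_right_mono\<close>)
  qed (use iN iab in auto)
  finally have dN: "d * N \<le> (LINT x|lborel. x powr b * H x)" .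
  have m0: "0 \<le> (LINT x|lborel. x powr b * H x)"
    using nonneg by (intro integral_nonneg_AE) auto
  have "c * J * N / 2 * (d * N) \<le> c * J * N / 2 * (LINT x|lborel. x powr b * H x)"
    using dN cJN by (rule mult_left_mono)
  also have "\<dots> \<le> (LINT x|lborel. w x * x powr a * H x) * (LINT x|lborel. x powr b * H x)"
    using rate[of a] m0 by (intro mult_right_mono) auto
  finally show ?thesis
    using A by (subst collision_integral_split) (use iab iw in \<open>auto simp: power2_eq_square mult_ac\<close>)
qed

text \<open>Fubini in time, with the indicators of the half-line moved into \<open>u\<close> so that
  the section has the form required of \<open>H\<close> above.\<close>

lemma collision_section_integrable:
  fixes t :: real
  assumes "set_integrable lborel ({0<..<t} \<times> {0<..} \<times> {0<..})
          (\<lambda>(\<tau>, x, y). (x powr k + y powr k) * \<Phi> x y * u \<tau> x * u \<tau> y)"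
  shows "AE \<tau>\<in>{0<..<t} in lborel. integrable (lborel \<Otimes>\<^sub>M lborel) (\<lambda>(x, y).
    (x powr k + y powr k) * \<Phi> x y * (indicator {0<..} x * u \<tau> x) * (indicator {0<..} y * u \<tau> y))"
proof -
  have "integrable (lborel \<Otimes>\<^sub>M lborel) (\<lambda>z. indicator ({0<..<t} \<times> {0<..} \<times> {0<..}) z *\<^sub>R
    (case z of (\<tau>, x, y) \<Rightarrow> (x powr k + y powr k) * \<Phi> x y * u \<tau> x * u \<tau> y))"
    using assms unfolding set_integrable_def lborel_prod .
  from lborel_pair.AE_integrable_fst'[OF this]
  show ?thesis
  proof eventually_elim
    case (elim \<tau>)
    then show ?case
      unfolding lborel_prod by (auto elim!: Bochner_Integration.integrable_cong[THEN iffD1, rotated 2] simp: indicator_def)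
  qed
qed

text \<open>The quotient of \<open>w x + w y\<close> by \<open>x powr k + y powr k\<close> is
  bounded by \<open>C\<close>, so the integrability built into weak solutions dominates the
  collision integrand. This makes the time integral in the weak formulation additive over
  intervals.\<close>

lemma collision_time_integrable:
  fixes w :: "real \<Rightarrow> real" and t :: real
  assumes int: "set_integrable lborel ({0<..<t} \<times> {0<..} \<times> {0<..})
          (\<lambda>(\<tau>, x, y). (x powr k + y powr k) * \<Phi> x y * u \<tau> x * u \<tau> y)"
    and [measurable]: "w \<in> borel_measurable borel"
    and w: "\<And>x. 0 < x \<Longrightarrow> \<bar>w x\<bar> \<le> C * x powr k"
  shows "set_integrable lborel {0<..<t} (\<lambda>\<tau>. LINT x:{0<..}|lborel. LINT y:{0<..}|lborel.
           (w x + w y) * \<Phi> x y * u \<tau> x * u \<tau> y)"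
proof -
  define K where "K = (\<lambda>z. indicator ({0<..<t} \<times> {0<..} \<times> {0<..}) z *\<^sub>R
    (case z of (\<tau>, x, y) \<Rightarrow> (x powr k + y powr k) * \<Phi> x y * u \<tau> x * u \<tau> y))"
  have K: "integrable (lborel \<Otimes>\<^sub>M (lborel \<Otimes>\<^sub>M lborel)) K"
    using int unfolding set_integrable_def lborel_prod K_def .
  note [measurable] = borel_measurable_integrable[OF K]
  \<comment> \<open>Written as a multiple of \<open>K\<close>, so that measurability is inherited
    from \<open>K\<close>, with no measurability of \<open>\<Phi>\<close> or \<open>u\<close>
    separately. Where the denominator could vanish, \<open>K\<close> is 0.\<close>
  define g where "g = (\<lambda>(\<tau>::real, x::real, y::real). (w x + w y) / (x powr k + y powr k) * K (\<tau>, x, y))"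
  have g: "integrable (lborel \<Otimes>\<^sub>M (lborel \<Otimes>\<^sub>M lborel)) g"
  proof (rule Bochner_Integration.integrable_bound)
    show "integrable (lborel \<Otimes>\<^sub>M (lborel \<Otimes>\<^sub>M lborel)) (\<lambda>z. C * K z)" using K by simp
    show "AE z in lborel \<Otimes>\<^sub>M (lborel \<Otimes>\<^sub>M lborel). norm (g z) \<le> norm (C * K z)"
    proof (rule AE_I2)
      fix z :: "real \<times> real \<times> real"
      obtain \<tau> x y where z: "z = (\<tau>, x, y)" by (cases z)
      show "norm (g z) \<le> norm (C * K z)"
      proof (cases "0 < x \<and> 0 < y")
        case True
        then have pos: "0 < x powr k + y powr k" by (simp add: add_pos_pos)
        have "\<bar>w x + w y\<bar> \<le> C * (x powr k + y powr k)"
          using w[of x] w[of y] True by (simp add: ring_distribs)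
        then have "\<bar>w x + w y\<bar> / (x powr k + y powr k) \<le> C" using pos by (simp add: pos_divide_le_eq)
        then have "\<bar>w x + w y\<bar> / (x powr k + y powr k) * \<bar>K z\<bar> \<le> \<bar>C\<bar> * \<bar>K z\<bar>"
          by (intro mult_right_mono) auto
        then show ?thesis using pos by (simp add: g_def z abs_mult)
      qed (auto simp: g_def z K_def)
    qed
  qed (simp add: g_def)
  note [measurable] = borel_measurable_integrable[OF g]
  define G where "G = (\<lambda>\<tau>. LINT x|lborel. LINT y|lborel. g (\<tau>, x, y))"
  have G1: "integrable lborel (\<lambda>\<tau>. LINT p|(lborel \<Otimes>\<^sub>M lborel). g (\<tau>, p))"
    using lborel_pair.integrable_fst'[of g] g by (simp add: lborel_prod)
  \<comment> \<open>The iterated integral agrees with the integral over the product only where the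
    section is integrable, hence for almost every time.\<close>
  have G2: "AE \<tau> in lborel. (LINT p|(lborel \<Otimes>\<^sub>M lborel). g (\<tau>, p)) = G \<tau>"
  proof -
    have "AE \<tau> in lborel. integrable (lborel \<Otimes>\<^sub>M lborel) (\<lambda>p. g (\<tau>, p))"
      using lborel_pair.AE_integrable_fst'[of g] g by (simp add: lborel_prod)
    then show ?thesis
      by eventually_elim (simp add: G_def lborel_pair.integral_fst'[symmetric])
  qed
  have "G \<in> borel_measurable lborel" unfolding G_def by measurable
  from integrable_cong_AE_imp[OF G1 this] have "integrable lborel G" using G2 by simp
  moreover have "G = (\<lambda>\<tau>. indicator {0<..<t} \<tau> *\<^sub>R (LINT x:{0<..}|lborel. LINT y:{0<..}|lborel.
           (w x + w y) * \<Phi> x y * u \<tau> x * u \<tau> y))"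
  proof (rule ext)
    fix \<tau>
    have "g (\<tau>, x, y) = indicator {0<..<t} \<tau> * (indicator {0<..} x * (indicator {0<..} y *
        ((w x + w y) * \<Phi> x y * u \<tau> x * u \<tau> y)))" for x y
    proof (cases "0 < x \<and> 0 < y")
      case True
      then have "x powr k + y powr k \<noteq> 0" by (simp add: add_pos_pos less_imp_neq[symmetric])
      then show ?thesis using True by (simp add: g_def K_def indicator_def)
    qed (auto simp: g_def K_def)
    then show "G \<tau> = indicator {0<..<t} \<tau> *\<^sub>R (LINT x:{0<..}|lborel. LINT y:{0<..}|lborel.
           (w x + w y) * \<Phi> x y * u \<tau> x * u \<tau> y)"
      by (simp add: G_def set_lebesgue_integral_def)
  qed
  ultimately show ?thesis unfolding set_integrable_def by simp
qed

subsection \<open>Growth below a threshold\<close>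

text \<open>
  Look at the last time at which \<open>S \<ge> \<theta>\<close>: afterwards \<open>S\<close> increases.  If there is no such time,
  \<open>S\<close> grows at speed \<open>r / 2\<close> from the start.
\<close>

lemma continuous_threshold_growth:
  fixes S F :: "real \<Rightarrow> real"
  assumes cont: "continuous_on {0..t} S" and "0 \<le> t" and "0 \<le> S 0"
    and F: "set_integrable lborel {0<..<t} F"
    and S: "\<And>s. s \<in> {0..t} \<Longrightarrow> S s = S 0 + 1 / 2 * (LINT \<tau>:{0<..<s}|lborel. F \<tau>)"
    and grow: "AE \<tau>\<in>{0<..<t} in lborel. S \<tau> < \<theta> \<longrightarrow> r \<le> F \<tau>" and "0 \<le> r"
  shows "min \<theta> (r * t / 2) \<le> S t"
proof -
  have inc: "r * (t - s) / 2 \<le> S t - S s" if s: "s \<in> {0..t}" and below: "\<And>\<tau>. \<tau> \<in> {s<..<t} \<Longrightarrow> S \<tau> < \<theta>" for s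
  proof -
    have sub: "set_integrable lborel A F" if "A \<subseteq> {0<..<t}" "A \<in> sets lborel" for A
      using set_integrable_subset[OF F] that by auto
    have "r * (t - s) = (LINT \<tau>:{s<..<t}|lborel. r)"
      using s by (simp add: set_lebesgue_integral_def)
    also have "\<dots> \<le> (LINT \<tau>:{s<..<t}|lborel. F \<tau>)"
      unfolding set_lebesgue_integral_def
    proof (intro integral_mono_AE)
      show "integrable lborel (\<lambda>\<tau>. indicator {s<..<t} \<tau> *\<^sub>R r)"
        using s by (intro integrable_scaleR_left) (simp add: integrable_indicator_iff)
      show "integrable lborel (\<lambda>\<tau>. indicator {s<..<t} \<tau> *\<^sub>R F \<tau>)"
        using sub[of "{s<..<t}"] s unfolding set_integrable_def by force
      show "AE \<tau> in lborel. indicator {s<..<t} \<tau> *\<^sub>R r \<le> indicator {s<..<t} \<tau> *\<^sub>R F \<tau>"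
        using grow by eventually_elim (use s below in \<open>auto simp: indicator_def\<close>)
    qed
    also have "\<dots> = (LINT \<tau>:{0<..<t}|lborel. F \<tau>) - (LINT \<tau>:{0<..<s}|lborel. F \<tau>)"
    proof -
      \<comment> \<open>The two sets differ at most by the point \<open>s\<close>, a null
        set.\<close>
      have "(LINT \<tau>:{0<..<t}|lborel. F \<tau>) = (LINT \<tau>:{0<..<s}\<union>{s<..<t}|lborel. F \<tau>)"
        unfolding set_lebesgue_integral_def
      proof (rule integral_cong_AE)
        show "AE x in lborel. indicator {0<..<t} x *\<^sub>R F x = indicator ({0<..<s} \<union> {s<..<t}) x *\<^sub>R F x"
          using AE_lborel_singleton[of s]
          by eventually_elim (use s in \<open>auto simp: indicator_def\<close>)
        show "(\<lambda>x. indicator {0<..<t} x *\<^sub>R F x) \<in> borel_measurable lborel"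
          using F unfolding set_integrable_def by (rule borel_measurable_integrable)
        show "(\<lambda>x. indicator ({0<..<s} \<union> {s<..<t}) x *\<^sub>R F x) \<in> borel_measurable lborel"
          using sub[of "{0<..<s} \<union> {s<..<t}"] s unfolding set_integrable_def
          by (intro borel_measurable_integrable) force
      qed
      also have "\<dots> = (LINT \<tau>:{0<..<s}|lborel. F \<tau>) + (LINT \<tau>:{s<..<t}|lborel. F \<tau>)"
        using s by (intro set_integral_Un sub) auto
      finally show ?thesis by simp
    qed
    finally show ?thesis using S[of s] S[of t] s by (simp add: field_simps)
  qed
  define K where "K = {s\<in>{0..t}. \<theta> \<le> S s}"
  show ?thesis
  proof (cases "K = {}")
    case True
    then have "S \<tau> < \<theta>" if "\<tau> \<in> {0<..<t}" for \<tau>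
    proof -
      have "\<tau> \<notin> K" using True by simp
      then show ?thesis using that by (auto simp: K_def)
    qed
    then have "r * (t - 0) / 2 \<le> S t - S 0"
      using \<open>0 \<le> t\<close> by (intro inc) auto
    then show ?thesis using \<open>0 \<le> S 0\<close> by simp
  next
    case False
    have "closed K" unfolding K_def
      using continuous_closed_preimage[OF cont, of "{\<theta>..}"]
      by (simp add: vimage_def Int_def)
    then have "compact K"
      using compact_Int_closed[of "{0..t}" K] by (simp add: K_def Int_def conj_ac)
    then obtain s where s: "s \<in> K" "\<And>\<tau>. \<tau> \<in> K \<Longrightarrow> \<tau> \<le> s"
      using compact_attains_sup[OF _ False] by blast
    have "S \<tau> < \<theta>" if "\<tau> \<in> {s<..<t}" for \<tau>
    proof -
      have "\<tau> \<notin> K" using s(2)[of \<tau>] that by auto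
      then show ?thesis using that s(1) by (auto simp: K_def)
    qed
    then have "r * (t - s) / 2 \<le> S t - S s"
      using s by (intro inc) (auto simp: K_def)
    moreover have "0 \<le> r * (t - s) / 2" using s \<open>0 \<le> r\<close> by (simp add: K_def)
    moreover have "\<theta> \<le> S s" using s(1) by (simp add: K_def)
    ultimately show ?thesis by linarith
  qed
qed

subsection \<open>Weak continuity and limits\<close>

lemma Xspace_measurable:
  assumes "g \<in> Xspace k"
  shows "(\<lambda>x. indicator {0<..} x * g x) \<in> borel_measurable borel"
proof -
  have [measurable]: "(\<lambda>x. indicator {0<..} x * (x powr k * g x)) \<in> borel_measurable borel"
    using assms unfolding Xspace_def set_integrable_def
    by (auto dest!: borel_measurable_integrable)
  have "(\<lambda>x. x powr (-k) * (indicator {0<..} x * (x powr k * g x))) \<in> borel_measurable borel"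
    by measurable
  also have "(\<lambda>x. x powr (-k) * (indicator {0<..} x * (x powr k * g x))) = (\<lambda>x. indicator {0<..} x * g x)"
    by (auto simp: indicator_def powr_minus field_simps)
  finally show ?thesis .
qed

text \<open>Integration against a density dominated by \<open>C * x powr k\<close> is bounded by
  \<open>C * Xnorm k\<close>. Weak continuity enters through such functionals: the window mass and
  the hat integral.\<close>

lemma integral_in_Xdual:
  assumes [measurable]: "\<psi> \<in> borel_measurable borel"
    and bound: "\<And>x. 0 < x \<Longrightarrow> \<bar>\<psi> x\<bar> \<le> C * x powr k"
  shows "(\<lambda>g. LINT x:{0<..}|lborel. \<psi> x * g x) \<in> Xdual k"
    and "g \<in> Xspace k \<Longrightarrow> set_integrable lborel {0<..} (\<lambda>x. \<psi> x * g x)"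
proof -
  have le: "norm (indicator {0<..} x *\<^sub>R (\<psi> x * g x)) \<le> C * (indicator {0<..} x *\<^sub>R (x powr k * \<bar>g x\<bar>))" for x and g :: "real \<Rightarrow> real"
    using mult_right_mono[OF bound[of x], of "\<bar>g x\<bar>"]
    by (auto simp: indicator_def abs_mult mult_ac)
  have abs: "integrable lborel (\<lambda>x. C * (indicator {0<..} x *\<^sub>R (x powr k * \<bar>g x\<bar>)))"
    if "g \<in> Xspace k" for g :: "real \<Rightarrow> real"
  proof -
    have "integrable lborel (\<lambda>x. indicator {0<..} x *\<^sub>R (x powr k * \<bar>g x\<bar>))"
      using integrable_abs[of lborel "\<lambda>x. indicator {0<..} x *\<^sub>R (x powr k * g x)"] that
      by (simp add: Xspace_def set_integrable_def abs_mult)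
    then show ?thesis by simp
  qed
  have int: "set_integrable lborel {0<..} (\<lambda>x. \<psi> x * g x)" if "g \<in> Xspace k" for g
    unfolding set_integrable_def
  proof (rule Bochner_Integration.integrable_bound[OF abs[OF that]])
    have "(\<lambda>x. \<psi> x * (indicator {0<..} x * g x)) \<in> borel_measurable borel"
      using Xspace_measurable[OF that] by measurable
    then show "(\<lambda>x. indicator {0<..} x *\<^sub>R (\<psi> x * g x)) \<in> borel_measurable lborel"
      by (simp add: mult_ac)
    show "AE x in lborel. norm (indicator {0<..} x *\<^sub>R (\<psi> x * g x))
      \<le> norm (C * (indicator {0<..} x *\<^sub>R (x powr k * \<bar>g x\<bar>)))"
      using le[of _ g] by (intro AE_I2) (metis abs_ge_self order_trans real_norm_def)
  qed
  then show "g \<in> Xspace k \<Longrightarrow> set_integrable lborel {0<..} (\<lambda>x. \<psi> x * g x)" .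
  have "\<bar>LINT x:{0<..}|lborel. \<psi> x * g x\<bar> \<le> C * Xnorm k g" if "g \<in> Xspace k" for g
  proof -
    have "\<bar>LINT x:{0<..}|lborel. \<psi> x * g x\<bar> \<le>
      (LINT x|lborel. norm (indicator {0<..} x *\<^sub>R (\<psi> x * g x)))"
      unfolding set_lebesgue_integral_def
      by (metis integral_norm_bound real_norm_def)
    also have "\<dots> \<le> (LINT x|lborel. C * (indicator {0<..} x *\<^sub>R (x powr k * \<bar>g x\<bar>)))"
      using int[OF that] abs[OF that] le[of _ g] unfolding set_integrable_def
      by (intro integral_mono integrable_norm) auto
    finally show ?thesis by (simp add: Xnorm_def set_lebesgue_integral_def)
  qed
  then show "(\<lambda>g. LINT x:{0<..}|lborel. \<psi> x * g x) \<in> Xdual k"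
    unfolding Xdual_def
    by (auto simp: ring_distribs mult.left_commute set_integral_add(2) int intro!: exI[of _ C])
qed

lemma AE_interval_witness:
  fixes t :: real
  assumes "AE \<tau>\<in>{0<..<t} in lborel. P \<tau>" "0 < t"
  obtains \<tau> where "\<tau> \<in> {0<..<t}" "P \<tau>"
proof -
  have "\<not> (AE \<tau> in lborel. \<tau> \<notin> {0<..<t})"
  proof
    assume "AE \<tau> in lborel. \<tau> \<notin> {0<..<t}"
    then have "emeasure lborel {0<..<t} = 0"
      by (subst (asm) AE_iff_measurable[where N = "{0<..<t}"]) auto
    then show False using \<open>0 < t\<close> by simp
  qed
  moreover have "AE \<tau> in lborel. \<tau> \<notin> {0<..<t}" if "\<And>\<tau>. \<tau> \<in> {0<..<t} \<Longrightarrow> \<not> P \<tau>"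
    using assms(1) by eventually_elim (use that in blast)
  ultimately show thesis using that by blast
qed

text \<open>\<open>x powr (s - 1)\<close> is monotone, so on \<open>[p, q]\<close> it is bounded
  below by its smaller endpoint value. If \<open>q < p\<close> the interval is empty and any
  constant works.\<close>

lemma powr_bounded_below_on_interval:
  fixes p q s K :: real
  assumes "0 < p" "0 < K"
  obtains c where "0 < c" "\<And>x. x \<in> {p..q} \<Longrightarrow> c * x \<le> K * x powr s"
proof -
  let ?m = "min (p powr (s - 1)) (q powr (s - 1))"
  show thesis
  proof (cases "p \<le> q")
    case True
    show thesis
    proof (rule that[of "K * ?m"])
      show "0 < K * ?m" using assms True by simp
      fix x assume x: "x \<in> {p..q}"
      have "?m \<le> x powr (s - 1)"
      proof (cases "0 \<le> s - 1")
        case True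
        then show ?thesis using x assms by (intro min.coboundedI1 powr_mono2) auto
      next
        case False
        then show ?thesis using x assms by (intro min.coboundedI2 powr_mono2') auto
      qed
      then have "K * (?m * x) \<le> K * (x powr (s - 1) * x powr 1)"
        using x assms by (intro mult_left_mono mult_mono) auto
      also have "x powr (s - 1) * x powr 1 = x powr s"
        by (simp only: powr_add[symmetric] diff_add_cancel)
      finally show "K * ?m * x \<le> K * x powr s" by (simp only: mult.assoc)
    qed
  qed (use that[of 1] in auto)
qed

text \<open>Dominated convergence along the windows \<open>[1/(n+1), n+1]\<close>, which exhaust the
  half-line.\<close>

lemma moment_window:
  assumes "0 < moment 1 g"
  obtains p q where "0 < p" "0 < (LINT x:{0<..}|lborel. indicator {p..q} x * x * g x)"
proof -
  \<comment> \<open>Again the default value 0 of the integral: a positive moment forces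
    integrability.\<close>
  have i: "integrable lborel (\<lambda>x. indicator {0<..} x *\<^sub>R (x powr 1 * g x))"
    using assms unfolding moment_def set_lebesgue_integral_def
    by (metis less_irrefl not_integrable_integral_eq)
  note [measurable] = borel_measurable_integrable[OF i]
  let ?s = "\<lambda>n x. indicator {1 / real (Suc n)..real (Suc n)} x *\<^sub>R (indicator {0<..} x *\<^sub>R (x powr 1 * g x))"
  have "(\<lambda>n. LINT x|lborel. ?s n x) \<longlonglongrightarrow> (LINT x|lborel. indicator {0<..} x *\<^sub>R (x powr 1 * g x))"
  proof (rule integral_dominated_convergence)
    show "integrable lborel (\<lambda>x. norm (indicator {0<..} x *\<^sub>R (x powr 1 * g x)))"
      using i by (rule integrable_norm)
    show "AE x in lborel. (\<lambda>n. ?s n x) \<longlonglongrightarrow> indicator {0<..} x *\<^sub>R (x powr 1 * g x)"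
    proof (rule AE_I2)
      fix x :: real
      show "(\<lambda>n. ?s n x) \<longlonglongrightarrow> indicator {0<..} x *\<^sub>R (x powr 1 * g x)"
      proof (cases "0 < x")
        case True
        have 1: "(\<lambda>n. 1 / real (Suc n)) \<longlonglongrightarrow> 0" by real_asymp
        have "\<forall>\<^sub>F n in sequentially. 1 / real (Suc n) < x" using True by (rule order_tendstoD[OF 1])
        moreover have "filterlim (\<lambda>n. real (Suc n)) at_top sequentially" by real_asymp
        then have "\<forall>\<^sub>F n in sequentially. x \<le> real (Suc n)" by (simp only: filterlim_at_top)
        ultimately have "\<forall>\<^sub>F n in sequentially. ?s n x = indicator {0<..} x *\<^sub>R (x powr 1 * g x)"
          by eventually_elim auto
        then show ?thesis by (rule tendsto_eventually)
      qed simp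
    qed
    show "AE x in lborel. norm (?s n x) \<le> norm (indicator {0<..} x *\<^sub>R (x powr 1 * g x))" for n
      by (intro AE_I2) (simp add: indicator_def)
  qed measurable
  then have "\<forall>\<^sub>F n in sequentially. 0 < (LINT x|lborel. ?s n x)"
    using assms by (intro order_tendstoD(1)) (auto simp: moment_def set_lebesgue_integral_def)
  then obtain n where "0 < (LINT x|lborel. ?s n x)"
    using eventually_happens sequentially_bot by blast
  also have "(LINT x|lborel. ?s n x) = (LINT x:{0<..}|lborel. indicator {1 / real (Suc n)..real (Suc n)} x * x * g x)"
    unfolding set_lebesgue_integral_def
    by (intro Bochner_Integration.integral_cong) (auto simp: indicator_def)
  finally show thesis by (rule that[rotated]) simp
qed

lemma integral_near_zero_tendsto:
  fixes f :: "real \<Rightarrow> real"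
  assumes f: "integrable lborel f"
  shows "(\<lambda>n. LINT x|lborel. indicator {0<..<3 / real (Suc n)} x * f x) \<longlonglongrightarrow> 0"
proof -
  note [measurable] = borel_measurable_integrable[OF f]
  have "(\<lambda>n. LINT x|lborel. indicator {0<..<3 / real (Suc n)} x * f x) \<longlonglongrightarrow> (LINT x::real|lborel. 0)"
  proof (rule integral_dominated_convergence)
    show "integrable lborel (\<lambda>x. norm (f x))" using f by (rule integrable_norm)
    show "AE x in lborel. (\<lambda>n. indicator {0<..<3 / real (Suc n)} x * f x) \<longlonglongrightarrow> 0"
    proof (rule AE_I2)
      fix x :: real
      show "(\<lambda>n. indicator {0<..<3 / real (Suc n)} x * f x) \<longlonglongrightarrow> 0"
      proof (cases "0 < x")
        case True
        have 1: "(\<lambda>n. 3 / real (Suc n)) \<longlonglongrightarrow> 0" by real_asymp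
        have "\<forall>\<^sub>F n in sequentially. 3 / real (Suc n) < x" using True by (rule order_tendstoD[OF 1])
        then have "\<forall>\<^sub>F n in sequentially. indicator {0<..<3 / real (Suc n)} x * f x = 0"
          by eventually_elim auto
        then show ?thesis by (rule tendsto_eventually)
      qed simp
    qed
  qed (auto simp: indicator_def)
  then show ?thesis by simp
qed

text \<open>On the support the hat is at most \<open>e\<close>, and \<open>e powr a\<close> is
  comparable to \<open>x powr a\<close>. The right-hand integral runs over sizes below
  \<open>3 * e\<close>, so it tends to 0 with \<open>e\<close> and the whole bound is
  \<open>o(e)\<close>.\<close>

lemma hat_integral_le:
  fixes H :: "real \<Rightarrow> real"
  assumes [measurable]: "H \<in> borel_measurable borel"
    and nonneg: "AE x in lborel. 0 \<le> H x"
    and i: "integrable lborel (\<lambda>x. x powr a * H x)" and e: "0 < e"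
  shows "e powr a * (LINT x|lborel. hat e x * H x)
    \<le> e * 3 powr \<bar>a\<bar> * (LINT x|lborel. indicator {0<..<3 * e} x * (x powr a * H x))"
proof -
  have i': "integrable lborel (\<lambda>x. indicator {0<..<3 * e} x * (x powr a * H x))"
    using integrable_mult_indicator[OF _ i, of "{0<..<3 * e}"] by simp
  have "(LINT x|lborel. e powr a * (hat e x * H x))
    \<le> (LINT x|lborel. e * 3 powr \<bar>a\<bar> * (indicator {0<..<3 * e} x * (x powr a * H x)))"
  proof (rule integral_mono_AE')
    show "integrable lborel (\<lambda>x. e * 3 powr \<bar>a\<bar> * (indicator {0<..<3 * e} x * (x powr a * H x)))"
      using i' by simp
    show "AE x in lborel. e powr a * (hat e x * H x) \<le> e * 3 powr \<bar>a\<bar> * (indicator {0<..<3 * e} x * (x powr a * H x))"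
      using nonneg
    proof eventually_elim
      case (elim x)
      show ?case
      proof (cases "x \<le> e \<or> 3 * e \<le> x")
        case False
        then have "e powr a * hat e x \<le> (3 powr \<bar>a\<bar> * x powr a) * e"
          using e hat_le[of e x] hat_nonneg[of e x] by (intro mult_mono powr_le_scaled) auto
        then have "e powr a * hat e x * H x \<le> (3 powr \<bar>a\<bar> * x powr a) * e * H x"
          using elim by (rule mult_right_mono)
        then show ?thesis using False e by (simp add: mult_ac)
      qed (use e elim in \<open>simp add: hat_eq_0\<close>)
    qed
    show "AE x in lborel. 0 \<le> e * 3 powr \<bar>a\<bar> * (indicator {0<..<3 * e} x * (x powr a * H x))"
      using nonneg by eventually_elim (use e in simp)
  qed
  then show ?thesis by simp
qed

theorem theorem2p4:
  fixes \<nu> lam1 lam2 k0 :: real and uin :: "real \<Rightarrow> real" and T :: ereal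
  assumes "- 2 < \<nu>" and "\<nu> \<le> - 1"
    and "lam1 \<le> lam2" and "lam2 \<le> 1"
    and "\<bar>\<nu>\<bar> - 1 < k0" and "k0 < 1"
    and "uin \<in> Xpos k0 \<inter> Xspace (1 + k0)"
    and "moment 1 uin > 0"
    and "0 < T"
    and "lam1 < \<bar>\<nu>\<bar> - 1" and "lam1 + lam2 < 1"
  shows "\<not> (\<exists>u. weak_solution k0 (sum_kernel lam1 lam2) (power_daughter \<nu>) uin T u
                \<and> mass_conserving uin T u)"
proof

  \<comment> \<open>Properties of a hypothetical solution\<close>
  assume "\<exists>u. weak_solution k0 (sum_kernel lam1 lam2) (power_daughter \<nu>) uin T u
                \<and> mass_conserving uin T u"
  then obtain u where u: "weak_solution k0 (sum_kernel lam1 lam2) (power_daughter \<nu>) uin T u" by blast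
  note par = \<open>- 2 < \<nu>\<close> \<open>\<nu> \<le> - 1\<close> \<open>lam1 \<le> lam2\<close> \<open>k0 < 1\<close>
  have k0: "- \<nu> - 1 \<le> k0" "0 < k0" and lam1: "lam1 < - \<nu> - 1" using assms by auto
  let ?I = "time_interval T" and ?\<Phi> = "sum_kernel lam1 lam2"
  have nonneg: "AE x\<in>{0<..} in lborel. 0 \<le> u t x" if "t \<in> ?I" for t
    using u that by (simp add: weak_solution_def)
  have X: "\<And>t. t \<in> ?I \<Longrightarrow> u t \<in> Xspace k0"
    and dual: "\<And>L. L \<in> Xdual k0 \<Longrightarrow> continuous_on ?I (\<lambda>t. L (u t))"
    using u by (auto simp: weak_solution_def continuous_map_Xweak_iff)
  have init: "AE x\<in>{0<..} in lborel. u 0 x = uin x"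
    and int: "\<And>t. 0 < t \<Longrightarrow> ereal t < T \<Longrightarrow> set_integrable lborel ({0<..<t} \<times> {0<..} \<times> {0<..})
          (\<lambda>(\<tau>, x, y). (x powr k0 + y powr k0) * ?\<Phi> x y * u \<tau> x * u \<tau> y)"
    and weak: "\<And>t \<sigma>. 0 < t \<Longrightarrow> ereal t < T \<Longrightarrow> \<sigma> \<in> test_functions k0 \<Longrightarrow>
        (LINT x:{0<..}|lborel. \<sigma> x * u t x) =
        (LINT x:{0<..}|lborel. \<sigma> x * uin x) +
        1 / 2 * (LINT \<tau>:{0<..<t}|lborel. (LINT x:{0<..}|lborel. (LINT y:{0<..}|lborel.
          Upsilon (power_daughter \<nu>) \<sigma> x y * ?\<Phi> x y * u \<tau> x * u \<tau> y)))"
    using u by (simp_all add: weak_solution_def)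
  have uin: "uin \<in> Xspace k0" using assms by (simp add: Xpos_def)
  obtain t0 where t0: "0 < t0" "ereal t0 < T"
    using \<open>0 < T\<close> ereal_dense2[of 0 T] by (auto simp: zero_ereal_def)
  have sub: "{0..t0} \<subseteq> ?I"
    using t0 by (auto simp: time_interval_def intro: le_less_trans[of _ "ereal t0"])
  \<comment> \<open>Extension by 0 to the whole line, which turns set integrals into plain
    ones.\<close>
  define H where "H t x = indicator {0<..} x * u t x" for t x :: real
  have H0: "H t x = 0" if "x \<le> 0" for t x using that by (simp add: H_def)
  have Hnn: "AE x in lborel. 0 \<le> H t x" if "t \<in> {0..t0}" for t
    using nonneg[of t] that sub by (auto elim!: eventually_mono simp: H_def indicator_def)
  have LH: "(LINT x:{0<..}|lborel. \<psi> x * u t x) = (LINT x|lborel. \<psi> x * H t x)" for \<psi> t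
    by (simp add: set_lebesgue_integral_def H_def mult_ac)
  have Hmeas: "H t \<in> borel_measurable borel" if "t \<in> {0..t0}" for t
    using Xspace_measurable[OF X[of t]] that sub unfolding H_def[abs_def] by auto
  \<comment> \<open>\<open>u 0\<close> and \<open>uin\<close> are only equal almost everywhere; this
    identifies their integrals against admissible densities.\<close>
  have at_0: "(LINT x:{0<..}|lborel. \<psi> x * u 0 x) = (LINT x:{0<..}|lborel. \<psi> x * uin x)"
    if [measurable]: "\<psi> \<in> borel_measurable borel" and "\<And>x. 0 < x \<Longrightarrow> \<bar>\<psi> x\<bar> \<le> C * x powr k0" for \<psi> C
  proof -
    have "0 \<in> ?I" using sub t0 by auto
    note borel_measurable_integrable[OF integral_in_Xdual(2)[OF that X[OF this], unfolded set_integrable_def]]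
      borel_measurable_integrable[OF integral_in_Xdual(2)[OF that uin, unfolded set_integrable_def]]
    then show ?thesis
      unfolding set_lebesgue_integral_def
      by (rule integral_cong_AE) (use init in \<open>auto elim!: eventually_mono simp: indicator_def\<close>)
  qed

  \<comment> \<open>A window that keeps mass on a short time interval\<close>
  obtain p q where p: "0 < p" and pq: "0 < (LINT x:{0<..}|lborel. indicator {p..q} x * x * uin x)"
    using moment_window assms(8) by blast
  \<comment> \<open>On the window \<open>x\<close> is at most \<open>x powr k0 / \<kappa>\<close>,
    so the window mass \<open>N\<close> is a weakly continuous functional of the solution.\<close>
  obtain \<kappa> where \<kappa>: "0 < \<kappa>" "\<And>x. x \<in> {p..q} \<Longrightarrow> \<kappa> * x \<le> 1 * x powr k0"
    by (rule powr_bounded_below_on_interval[OF p, of 1 q k0]) auto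
  have win: "\<bar>indicator {p..q} x * x\<bar> \<le> 1 / \<kappa> * x powr k0" if "0 < x" for x :: real
    using \<kappa>(2)[of x] \<kappa>(1) that by (auto simp: indicator_def field_simps)
  have win_meas: "(\<lambda>x. indicator {p..q} x * x) \<in> borel_measurable borel" by measurable
  define N where "N t = (LINT x|lborel. indicator {p..q} x * x * H t x)" for t
  have Ncont: "continuous_on {0..t0} N"
    using continuous_on_subset[OF dual[OF integral_in_Xdual(1)[OF win_meas win]] sub]
    unfolding LH N_def[symmetric] .
  have "0 < N 0"
    using pq at_0[OF win_meas win] by (simp add: LH N_def)
  then obtain d where d: "0 < d" "\<And>t. t \<in> {0..t0} \<Longrightarrow> dist t 0 < d \<Longrightarrow> dist (N t) (N 0) < N 0 / 2"
    using Ncont[unfolded continuous_on_iff, rule_format, of 0 "N 0 / 2"] t0 by auto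
  define n0 where "n0 = N 0 / 2"
  have n0: "0 < n0" using \<open>0 < N 0\<close> by (simp add: n0_def)
  \<comment> \<open>Half of \<open>d\<close>, so that the closed interval \<open>[0, t1]\<close>
    stays at distance less than \<open>d\<close> from 0 and \<open>N\<close> keeps at least half of
    its initial value there.\<close>
  define t1 where "t1 = min t0 (d / 2)"
  have t1: "0 < t1" "t1 \<le> t0" "ereal t1 < T" using t0 d by (auto simp: t1_def min_def intro: le_less_trans[of _ "ereal t0"])
  have Nge: "n0 \<le> N t" if "t \<in> {0..t1}" for t
  proof -
    have "dist (N t) (N 0) < N 0 / 2" using that d(1) by (intro d(2)) (auto simp: t1_def)
    then show ?thesis unfolding n0_def dist_real_def by linarith
  qed
  note intg = int[OF t1(1,3)]
  have sec: "AE \<tau>\<in>{0<..<t1} in lborel. integrable (lborel \<Otimes>\<^sub>M lborel) (\<lambda>(x, y).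
      (x powr k0 + y powr k0) * ?\<Phi> x y * H \<tau> x * H \<tau> y)"
    using collision_section_integrable[OF intg] by (simp add: H_def)

  \<comment> \<open>Constants for gain and moments on the window\<close>
  obtain c1 where c1: "0 < c1" "\<And>x. x \<in> {p..q} \<Longrightarrow> c1 * x \<le> (\<nu> + 2) * x powr (- \<nu> - 1 + lam1)"
    by (rule powr_bounded_below_on_interval[OF p, of "\<nu> + 2" q "- \<nu> - 1 + lam1"]) (use par in auto)
  obtain c2 where c2: "0 < c2" "\<And>x. x \<in> {p..q} \<Longrightarrow> c2 * x \<le> (\<nu> + 2) * x powr (- \<nu> - 1 + lam2)"
    by (rule powr_bounded_below_on_interval[OF p, of "\<nu> + 2" q "- \<nu> - 1 + lam2"]) (use par in auto)
  define c where "c = min c1 c2"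
  have c: "0 < c" using c1 c2 by (simp add: c_def)
  have c': "c * x \<le> (\<nu> + 2) * x powr (- \<nu> - 1) * x powr s" if "x \<in> {p..q}" "s \<in> {lam1, lam2}" for x s
  proof -
    have "c * x \<le> c1 * x" "c * x \<le> c2 * x"
      unfolding c_def using that p by (intro mult_right_mono; simp)+
    then show ?thesis using c1(2)[of x] c2(2)[of x] that by (auto simp: powr_add mult.assoc)
  qed
  obtain d' where d': "0 < d'" "\<And>x. x \<in> {p..q} \<Longrightarrow> d' * x \<le> 1 * x powr lam2"
    by (rule powr_bounded_below_on_interval[OF p, of 1 q lam2]) auto

  \<comment> \<open>Lower bound on small fragments, uniform in the scale\<close>
  define \<eta> where "\<eta> t = 3 powr \<nu> / 2 * min (c * n0 / (2 * 3 powr \<bar>lam1\<bar>)) (c * d' * n0\<^sup>2 * t / 2)" for t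
  \<comment> \<open>The two entries of \<open>\<eta> t\<close> come from the threshold
    \<open>\<theta>\<close> and from the growth \<open>r * t / 2\<close> below, multiplied by
    \<open>e powr lam1\<close> and with \<open>J\<close> bounded below by a multiple of
    \<open>e powr (\<nu> + 2)\<close>. The factor \<open>\<eta> t\<close> is free of
    \<open>e\<close>.\<close>
  have lower: "\<eta> t * e \<le> e powr lam1 * (LINT x|lborel. hat e x * H t x)"
    if e: "0 < e" "3 * e \<le> 1" "3 * e \<le> p" and t: "t \<in> {0<..<t1}" for e t
  proof -
    define w where "w x = frag_moment \<nu> (hat e) x - hat e x" for x
    define J where "J = (LINT z|lborel. hat e z * z powr \<nu>)"
    define S where "S t = (LINT x|lborel. hat e x * H t x)" for t
    define F where "F \<tau> = (LINT x:{0<..}|lborel. LINT y:{0<..}|lborel.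
           (w x + w y) * ?\<Phi> x y * u \<tau> x * u \<tau> y)" for \<tau>
    have test: "hat e \<in> test_functions k0" using e k0 par by (intro hat_test_function) auto
    have hat_abs: "\<bar>hat e x\<bar> \<le> e * e powr (- k0) * x powr k0" if "0 < x" for x
      using hat_bound_powr[of e k0 x] hat_nonneg[of e x] that e k0 by simp
    have J0: "0 \<le> J" unfolding J_def using hat_nonneg by (auto intro!: integral_nonneg)
    \<comment> \<open>As \<open>e \<le> 1\<close>, it suffices that the total exponent
      \<open>s + \<nu> + 2\<close> is at most 1. For \<open>s = 0\<close> this is
      \<open>\<nu> \<le> -1\<close>; for \<open>s = lam1\<close> it follows from
      \<open>lam1 < - \<nu> - 1\<close>.\<close>
    have Jge: "3 powr \<nu> / 2 * e \<le> e powr s * J" if "s \<le> - \<nu> - 1" for s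
    proof -
      have "e powr 1 \<le> e powr (s + (\<nu> + 2))" using e that by (intro powr_mono') auto
      then have "3 powr \<nu> / 2 * e \<le> e powr s * (3 powr \<nu> / 2 * e powr (\<nu> + 2))"
        using e by (simp add: powr_add)
      also have "\<dots> \<le> e powr s * J"
        unfolding J_def using e par by (intro mult_left_mono hat_powr_integral_ge) auto
      finally show ?thesis .
    qed
    \<comment> \<open>Chosen so that \<open>S \<tau> < \<theta>\<close> and
      \<open>n0 \<le> N \<tau>\<close> give the smallness assumption of
      \<open>collision_rate_ge\<close>; \<open>r\<close> is the resulting rate with
      \<open>n0\<close> in place of \<open>N \<tau>\<close>.\<close>
    define \<theta> where "\<theta> = c * J * n0 / (2 * 3 powr \<bar>lam1\<bar> * e powr lam1)"
    define r where "r = c * d' * J * n0\<^sup>2"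
    have [measurable]: "w \<in> borel_measurable borel"
      unfolding w_def[abs_def] using frag_moment_hat(1)[of e \<nu>] e par by measurable
    \<comment> \<open>The sum of the order-\<open>k0\<close> growth constants of
      \<open>frag_moment \<nu> (hat e)\<close> and \<open>hat e\<close>.\<close>
    define C where "C = (\<nu> + 2) * J * e powr (- \<nu> - 1 - k0) + e * e powr (- k0)"
    have wC: "\<bar>w x\<bar> \<le> C * x powr k0" if "0 < x" for x
      using frag_moment_hat(2)[of e \<nu> x] frag_moment_hat(4)[of e \<nu> k0 x] hat_abs[OF that] e par k0 that
      by (auto simp: w_def C_def J_def ring_distribs abs_le_iff)
    have F: "set_integrable lborel {0<..<t1} F"
      unfolding F_def[abs_def] by (rule collision_time_integrable[OF intg _ wC]) auto
    have UF: "(LINT x:{0<..}|lborel. LINT y:{0<..}|lborel.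
        Upsilon (power_daughter \<nu>) (hat e) x y * ?\<Phi> x y * u \<tau> x * u \<tau> y) = F \<tau>" for \<tau>
      unfolding F_def
      by (intro set_lebesgue_integral_cong)
        (auto simp: Upsilon_power_daughter[OF integrable_hat_powr[OF e(1)]] w_def intro!: set_lebesgue_integral_cong)
    have S0: "S 0 = (LINT x:{0<..}|lborel. hat e x * uin x)"
      using at_0[of "hat e", OF measurable_hat hat_abs] unfolding LH S_def .
    have Seq: "S s = S 0 + 1 / 2 * (LINT \<tau>:{0<..<s}|lborel. F \<tau>)" if "s \<in> {0..t1}" for s
    proof (cases "s = 0")
      case False
      then have "0 < s" "ereal s < T" using that t1 by (auto intro: le_less_trans[of _ "ereal t1"])
      moreover have "S s = (LINT x:{0<..}|lborel. hat e x * u s x)" by (simp only: S_def LH)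
      ultimately show ?thesis using weak[OF _ _ test, of s, unfolded UF] by (simp only: S0)
    qed (simp add: set_lebesgue_integral_def)
    have FH: "F \<tau> = (LINT x|lborel. LINT y|lborel. (w x + w y) * ?\<Phi> x y * H \<tau> x * H \<tau> y)" for \<tau>
      unfolding F_def set_lebesgue_integral_def
    proof (intro Bochner_Integration.integral_cong refl)
      fix x
      show "indicator {0<..} x *\<^sub>R (LINT y|lborel. indicator {0<..} y *\<^sub>R
          ((w x + w y) * ?\<Phi> x y * u \<tau> x * u \<tau> y))
        = (LINT y|lborel. (w x + w y) * ?\<Phi> x y * H \<tau> x * H \<tau> y)"
        by (cases "0 < x") (auto simp: H_def mult_ac)
    qed
    have "min \<theta> (r * t / 2) \<le> S t"
    proof (rule continuous_threshold_growth)
      show "continuous_on {0..t} S"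
        using continuous_on_subset[OF dual[OF integral_in_Xdual(1)[OF measurable_hat hat_abs]], of "{0..t}"] sub t t1
        unfolding LH S_def[symmetric] by force
      show "0 \<le> t" using t by simp
      show "0 \<le> S 0"
        unfolding S_def using Hnn[of 0] t0
        by (intro integral_nonneg_AE) (auto elim!: eventually_mono simp: hat_nonneg)
      show "set_integrable lborel {0<..<t} F"
        by (rule set_integrable_subset[OF F]) (use t in auto)
      show "S s = S 0 + 1 / 2 * (LINT \<tau>:{0<..<s}|lborel. F \<tau>)" if "s \<in> {0..t}" for s
        using Seq[of s] that t by simp
      show "0 \<le> r" using J0 c d' by (simp add: r_def)
      \<comment> \<open>The rate estimate is available at those times whose collision section is
        integrable, hence almost everywhere.\<close>
      show "AE \<tau>\<in>{0<..<t} in lborel. S \<tau> < \<theta> \<longrightarrow> r \<le> F \<tau>"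
        using sec
      proof eventually_elim
        case (elim \<tau>)
        show ?case
        proof (intro impI)
          assume \<tau>: "\<tau> \<in> {0<..<t}" and "S \<tau> < \<theta>"
          have N\<tau>: "n0 \<le> N \<tau>" using Nge[of \<tau>] \<tau> t by simp
          have "2 * 3 powr \<bar>lam1\<bar> * e powr lam1 * S \<tau> \<le> 2 * 3 powr \<bar>lam1\<bar> * e powr lam1 * \<theta>"
            using \<open>S \<tau> < \<theta>\<close> by (intro mult_left_mono) auto
          also have "\<dots> = c * J * n0" using e by (simp add: \<theta>_def)
          also have "\<dots> \<le> c * J * N \<tau>" using N\<tau> c J0 by (intro mult_left_mono) auto
          finally have small: "2 * 3 powr \<bar>lam1\<bar> * e powr lam1 * S \<tau> \<le> c * J * N \<tau>" .
          have "r \<le> c * d' * J * (N \<tau>)\<^sup>2"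
            unfolding r_def using N\<tau> n0 c d' J0 by (intro mult_left_mono power_mono) auto
          also have "\<dots> \<le> F \<tau>"
            unfolding FH J_def N_def w_def
            using elim \<tau> t t1 H0 Hmeas[of \<tau>] Hnn[of \<tau>] p par k0 e c c' d'(2) N\<tau> n0 small
            by (intro collision_rate_ge[where k = k0]) (auto simp: N_def J_def S_def)
          finally show "r \<le> F \<tau>" .
        qed
      qed
    qed
    then have "e powr lam1 * min \<theta> (r * t / 2) \<le> e powr lam1 * S t"
      by (intro mult_left_mono) auto
    moreover have "e powr lam1 * min \<theta> (r * t / 2) = min (e powr lam1 * \<theta>) (e powr lam1 * (r * t / 2))"
      by (simp add: min_mult_distrib_left)
    moreover have "3 powr \<nu> / 2 * e * (c * n0 / (2 * 3 powr \<bar>lam1\<bar>)) \<le> e powr lam1 * \<theta>"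
    proof -
      have "3 powr \<nu> / 2 * e * (c * n0 / (2 * 3 powr \<bar>lam1\<bar>)) \<le> J * (c * n0 / (2 * 3 powr \<bar>lam1\<bar>))"
        using Jge[of 0] par e c n0 by (intro mult_right_mono) auto
      then show ?thesis using e by (simp add: \<theta>_def mult_ac)
    qed
    moreover have "3 powr \<nu> / 2 * e * (c * d' * n0\<^sup>2 * t / 2) \<le> e powr lam1 * (r * t / 2)"
    proof -
      have "3 powr \<nu> / 2 * e * (c * d' * n0\<^sup>2 * t / 2) \<le> e powr lam1 * J * (c * d' * n0\<^sup>2 * t / 2)"
        using Jge[of lam1] lam1 c d' t by (intro mult_right_mono) auto
      then show ?thesis by (simp add: r_def mult_ac)
    qed
    moreover have "\<eta> t * e = min (3 powr \<nu> / 2 * e * (c * n0 / (2 * 3 powr \<bar>lam1\<bar>)))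
        (3 powr \<nu> / 2 * e * (c * d' * n0\<^sup>2 * t / 2))"
      using e by (simp add: \<eta>_def min_mult_distrib_left mult_ac)
    ultimately show ?thesis unfolding S_def by linarith
  qed

  \<comment> \<open>Contradiction as the scale tends to 0\<close>
  obtain t where t: "t \<in> {0<..<t1}" and ti: "integrable (lborel \<Otimes>\<^sub>M lborel) (\<lambda>(x, y).
      (x powr k0 + y powr k0) * ?\<Phi> x y * H t x * H t y)"
    using AE_interval_witness[OF sec t1(1)] by blast
  have tt: "t \<in> {0..t0}" using t t1 by simp
  have nz: "\<not> (AE x in lborel. H t x = 0)"
  proof
    assume "AE x in lborel. H t x = 0"
    then have "N t = (LINT x::real|lborel. 0)"
      unfolding N_def using Hmeas[OF tt] by (intro integral_cong_AE) auto
    then show False using Nge[of t] t n0 by simp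
  qed
  \<comment> \<open>At the chosen time the moment of order \<open>lam1\<close> is finite, because
    the section is integrable and the window still carries mass.\<close>
  have i: "integrable lborel (\<lambda>x. x powr lam1 * H t x)"
    by (rule integrable_powr_of_collision[OF Hmeas[OF tt] H0 ti nz]) auto
  have \<eta>0: "0 < \<eta> t / 3 powr \<bar>lam1\<bar>"
    using c d' n0 t by (simp add: \<eta>_def)
  have lim: "(\<lambda>n. 1 / real (Suc n)) \<longlonglongrightarrow> 0" by real_asymp
  have "\<forall>\<^sub>F n in sequentially. 1 / real (Suc n) < min (1 / 3) (p / 3)"
    using p by (intro order_tendstoD[OF lim]) auto
  moreover have "\<forall>\<^sub>F n in sequentially.
      (LINT x|lborel. indicator {0<..<3 / real (Suc n)} x * (x powr lam1 * H t x)) < \<eta> t / 3 powr \<bar>lam1\<bar>"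
    using \<eta>0 by (rule order_tendstoD[OF integral_near_zero_tendsto[OF i]])
  \<comment> \<open>With \<open>e = 1/(n+1)\<close> for large \<open>n\<close>, the lower bound
    \<open>\<eta> t * e\<close> meets an upper bound strictly below
    \<open>\<eta> t * e\<close>.\<close>
  ultimately have "\<forall>\<^sub>F n in sequentially. False"
  proof eventually_elim
    case (elim n)
    define e where "e = 1 / real (Suc n)"
    have e: "0 < e" "3 * e \<le> 1" "3 * e \<le> p" using elim(1) by (auto simp: e_def)
    have "\<eta> t * e \<le> e * 3 powr \<bar>lam1\<bar> * (LINT x|lborel. indicator {0<..<3 * e} x * (x powr lam1 * H t x))"
      using lower[OF e t] hat_integral_le[OF Hmeas[OF tt] Hnn[OF tt] i e(1)] by simp
    also have "\<dots> < e * 3 powr \<bar>lam1\<bar> * (\<eta> t / 3 powr \<bar>lam1\<bar>)"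
      using elim(2) e(1) by (intro mult_strict_left_mono) (auto simp: e_def)
    also have "\<dots> = \<eta> t * e" by simp
    finally show False by simp
  qed
  then show False by simp
qed

end
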